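(* For each infinite cardinal $\kappa$ there exists a non-right perfect ring $R$ such that for each right $R$-module $M$ which can be generated by at most $\kappa$ elements, $M$ is projective if and only if $M$ is $R$-projective. Namely, for any skew-field $K$, one can take $R$ to be the endomorphism ring of a $\kappa$-dimensional left vector space over $K$.
   Context: Rings are associative with unit; modules are right modules. A right $R$-module $M$ is $R$-projective if for each right ideal $I$ of $R$, each homomorphism $M\to R/I$ factorises through the canonical projection $R\to R/I$. Convention: the endomorphism ring is viewed so that $R$ contains a right ideal which is a free right $R$-module of rank $\kappa$. Concretely, endomorphisms of the left vector space are written on the left of their arguments and multiplied in the endomorphism ring accordingly or oppositely; the ring of all $\kappa\times\kappa$ column-finite or row-finite matrices over $K$ is meant with the side convention for which a surjective endomorphism is left invertible in $R$ (that is, the product $rs$ means: apply $r$ first, then $s$). *)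

theory Defs
  imports "HOL-Algebra.Module" "HOL-Algebra.AbelCoset"
begin

unbundle cardinal_syntax

section \<open>Modules over a not necessarily commutative ring\<close>

text \<open>
  The library locale \<^locale>\<open>module\<close> assumes a commutative ring. Here its record type is reused for
  one-sided modules. The record always stores the scalar as the first argument of \<^const>\<open>smult\<close>; for
  right modules we write \<open>x \<triangleleft>\<^bsub>M\<^esub> a\<close>, and it is the associativity law that makes the module a
  right one. The library predicate \<^term>\<open>submodule N R M\<close> (an additive subgroup closed under the
  scalars) makes no use of commutativity or of the side, and is used for both kinds of modules.
\<close>

abbreviation rsmult :: "('a, 'b, 'x) module_scheme \<Rightarrow> 'b \<Rightarrow> 'a \<Rightarrow> 'b" (infixl "\<triangleleft>\<index>" 70)
  where "rsmult M x a \<equiv> smult M a x"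

locale right_module = R?: ring R + M?: abelian_group M
  for R :: "('a, 'x) ring_scheme" (structure) and M :: "('a, 'b) module" (structure) +
  assumes rsmult_closed [simp, intro]:
      "\<lbrakk>x \<in> carrier M; a \<in> carrier R\<rbrakk> \<Longrightarrow> x \<triangleleft>\<^bsub>M\<^esub> a \<in> carrier M"
    and rsmult_add_scalar:
      "\<lbrakk>x \<in> carrier M; a \<in> carrier R; b \<in> carrier R\<rbrakk> \<Longrightarrow>
        x \<triangleleft>\<^bsub>M\<^esub> (a \<oplus>\<^bsub>R\<^esub> b) = x \<triangleleft>\<^bsub>M\<^esub> a \<oplus>\<^bsub>M\<^esub> x \<triangleleft>\<^bsub>M\<^esub> b"
    and rsmult_add_vector:
      "\<lbrakk>x \<in> carrier M; y \<in> carrier M; a \<in> carrier R\<rbrakk> \<Longrightarrow>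
        (x \<oplus>\<^bsub>M\<^esub> y) \<triangleleft>\<^bsub>M\<^esub> a = x \<triangleleft>\<^bsub>M\<^esub> a \<oplus>\<^bsub>M\<^esub> y \<triangleleft>\<^bsub>M\<^esub> a"
    and rsmult_assoc:
      "\<lbrakk>x \<in> carrier M; a \<in> carrier R; b \<in> carrier R\<rbrakk> \<Longrightarrow>
        x \<triangleleft>\<^bsub>M\<^esub> (a \<otimes>\<^bsub>R\<^esub> b) = (x \<triangleleft>\<^bsub>M\<^esub> a) \<triangleleft>\<^bsub>M\<^esub> b"
    and rsmult_one [simp]: "x \<in> carrier M \<Longrightarrow> x \<triangleleft>\<^bsub>M\<^esub> \<one>\<^bsub>R\<^esub> = x"

locale left_module = R?: ring R + M?: abelian_group M
  for R :: "('a, 'x) ring_scheme" (structure) and M :: "('a, 'b) module" (structure) +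
  assumes lsmult_closed [simp, intro]:
      "\<lbrakk>a \<in> carrier R; x \<in> carrier M\<rbrakk> \<Longrightarrow> a \<odot>\<^bsub>M\<^esub> x \<in> carrier M"
    and lsmult_add_scalar:
      "\<lbrakk>a \<in> carrier R; b \<in> carrier R; x \<in> carrier M\<rbrakk> \<Longrightarrow>
        (a \<oplus>\<^bsub>R\<^esub> b) \<odot>\<^bsub>M\<^esub> x = a \<odot>\<^bsub>M\<^esub> x \<oplus>\<^bsub>M\<^esub> b \<odot>\<^bsub>M\<^esub> x"
    and lsmult_add_vector:
      "\<lbrakk>a \<in> carrier R; x \<in> carrier M; y \<in> carrier M\<rbrakk> \<Longrightarrow>
        a \<odot>\<^bsub>M\<^esub> (x \<oplus>\<^bsub>M\<^esub> y) = a \<odot>\<^bsub>M\<^esub> x \<oplus>\<^bsub>M\<^esub> a \<odot>\<^bsub>M\<^esub> y"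
    and lsmult_assoc:
      "\<lbrakk>a \<in> carrier R; b \<in> carrier R; x \<in> carrier M\<rbrakk> \<Longrightarrow>
        (a \<otimes>\<^bsub>R\<^esub> b) \<odot>\<^bsub>M\<^esub> x = a \<odot>\<^bsub>M\<^esub> (b \<odot>\<^bsub>M\<^esub> x)"
    and lsmult_one [simp]: "x \<in> carrier M \<Longrightarrow> \<one>\<^bsub>R\<^esub> \<odot>\<^bsub>M\<^esub> x = x"

text \<open>Homomorphisms are only constrained on the carrier.\<close>

definition mod_hom ::
  "('a, 'x) ring_scheme \<Rightarrow> ('a, 'b) module \<Rightarrow> ('a, 'c) module \<Rightarrow> ('b \<Rightarrow> 'c) set" where
  "mod_hom R M N = {f \<in> carrier M \<rightarrow> carrier N.
     (\<forall>x\<in>carrier M. \<forall>y\<in>carrier M. f (x \<oplus>\<^bsub>M\<^esub> y) = f x \<oplus>\<^bsub>N\<^esub> f y) \<and>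
     (\<forall>x\<in>carrier M. \<forall>a\<in>carrier R. f (a \<odot>\<^bsub>M\<^esub> x) = a \<odot>\<^bsub>N\<^esub> f x)}"

definition generates :: "('a, 'x) ring_scheme \<Rightarrow> ('a, 'b) module \<Rightarrow> 'b set \<Rightarrow> bool" where
  "generates R M X \<longleftrightarrow>
     X \<subseteq> carrier M \<and> (\<forall>N. submodule N R M \<and> X \<subseteq> N \<longrightarrow> N = carrier M)"

definition generated_by_at_most ::
  "('a, 'x) ring_scheme \<Rightarrow> ('a, 'b) module \<Rightarrow> 'c rel \<Rightarrow> bool" where
  "generated_by_at_most R M \<kappa> \<longleftrightarrow> (\<exists>X. generates R M X \<and> |X| \<le>o \<kappa>)"

definition regular_right_module :: "('a, 'x) ring_scheme \<Rightarrow> ('a, 'a) module" where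
  "regular_right_module R =
     \<lparr>carrier = carrier R, mult = mult R, one = one R, zero = zero R, add = add R,
      smult = (\<lambda>a x. x \<otimes>\<^bsub>R\<^esub> a)\<rparr>"

definition right_ideal :: "'a set \<Rightarrow> ('a, 'x) ring_scheme \<Rightarrow> bool" where
  "right_ideal I R \<longleftrightarrow> submodule I R (regular_right_module R)"

text \<open>The \<open>mult\<close> and \<open>one\<close> fields of a module record carry no meaning.\<close>

definition quotient_right_module :: "('a, 'b) module \<Rightarrow> 'b set \<Rightarrow> ('a, 'b set) module" where
  "quotient_right_module M N =
     \<lparr>carrier = a_rcosets\<^bsub>M\<^esub> N, mult = undefined, one = undefined, zero = N, add = set_add M,
      smult = (\<lambda>a X. \<Union>x\<in>X. N +>\<^bsub>M\<^esub> (x \<triangleleft>\<^bsub>M\<^esub> a))\<rparr>"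

section \<open>Projectivity, R-projectivity and right perfect rings\<close>

text \<open>
  Projectivity is the lifting property against all epimorphisms. Quantification over modules inside
  a definition is confined to fixed types; the two types chosen lose nothing, because they contain
  the canonical epimorphism onto \<open>M\<close> from the free module on the carrier of \<open>M\<close>. The lemma
  \<open>projective_lift\<close> below gives lifting against epimorphisms between modules of arbitrary types.
\<close>

definition projective :: "('a, 'x) ring_scheme \<Rightarrow> ('a, 'b) module \<Rightarrow> bool" where
  "projective R M \<longleftrightarrow> right_module R M \<and>
     (\<forall>(N :: ('a, 'b \<Rightarrow> 'a) module) (P :: ('a, 'b) module).
        right_module R N \<and> right_module R P \<longrightarrow>
        (\<forall>p \<in> mod_hom R N P. p ` carrier N = carrier P \<longrightarrow>
          (\<forall>f \<in> mod_hom R M P. \<exists>g \<in> mod_hom R M N. \<forall>x\<in>carrier M. p (g x) = f x)))"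

definition R_projective :: "('a, 'x) ring_scheme \<Rightarrow> ('a, 'b) module \<Rightarrow> bool" where
  "R_projective R M \<longleftrightarrow> right_module R M \<and>
     (\<forall>I. right_ideal I R \<longrightarrow>
        (\<forall>f \<in> mod_hom R M (quotient_right_module (regular_right_module R) I).
           \<exists>g \<in> mod_hom R M (regular_right_module R). \<forall>x\<in>carrier M. f x = I +>\<^bsub>R\<^esub> g x))"

definition superfluous :: "('a, 'x) ring_scheme \<Rightarrow> ('a, 'b) module \<Rightarrow> 'b set \<Rightarrow> bool" where
  "superfluous R M N \<longleftrightarrow> submodule N R M \<and>
     (\<forall>L. submodule L R M \<and> N <+>\<^bsub>M\<^esub> L = carrier M \<longrightarrow> L = carrier M)"

definition projective_cover ::
  "('a, 'x) ring_scheme \<Rightarrow> ('a, 'p) module \<Rightarrow> ('p \<Rightarrow> 'b) \<Rightarrow> ('a, 'b) module \<Rightarrow> bool" where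
  "projective_cover R P f M \<longleftrightarrow> projective R P \<and> f \<in> mod_hom R P M \<and>
     f ` carrier P = carrier M \<and> superfluous R P (a_kernel P M f)"

text \<open>
  Bass: a ring is right perfect if every right module has a projective cover. It suffices to test
  the countably generated modules (Bass's proof of his Theorem P only uses these), and every such
  module is isomorphic to one whose elements are subsets of \<open>nat \<Rightarrow> 'a\<close>, namely cosets in
  the free module of countable rank. Whenever a module with elements in \<open>'b\<close> has a projective cover
  of any type, it has one with elements in \<open>'b \<Rightarrow> 'a\<close>: see \<open>projective_cover_universe\<close> below.
  So \<open>\<not> right_perfect R\<close> exhibits a module that has no projective cover whatsoever.
\<close>

definition right_perfect :: "('a, 'x) ring_scheme \<Rightarrow> bool" where
  "right_perfect R \<longleftrightarrow>
     (\<forall>M :: ('a, (nat \<Rightarrow> 'a) set) module. right_module R M \<longrightarrow>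
        (\<exists>(P :: ('a, (nat \<Rightarrow> 'a) set \<Rightarrow> 'a) module) f. projective_cover R P f M))"

section \<open>Vector spaces over skew-fields and their endomorphism rings\<close>

locale skew_field = ring R for R :: "('a, 'x) ring_scheme" (structure) +
  assumes one_not_zero: "\<one> \<noteq> \<zero>"
    and nonzero_units: "Units R = carrier R - {\<zero>}"

definition is_basis :: "('a, 'x) ring_scheme \<Rightarrow> ('a, 'v) module \<Rightarrow> 'v set \<Rightarrow> bool" where
  "is_basis K V B \<longleftrightarrow> generates K V B \<and>
     (\<forall>A c. finite A \<and> A \<subseteq> B \<and> c \<in> A \<rightarrow> carrier K \<and>
        (\<Oplus>\<^bsub>V\<^esub>b\<in>A. c b \<odot>\<^bsub>V\<^esub> b) = \<zero>\<^bsub>V\<^esub> \<longrightarrow> (\<forall>b\<in>A. c b = \<zero>\<^bsub>K\<^esub>))"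

definition has_dimension :: "('a, 'x) ring_scheme \<Rightarrow> ('a, 'v) module \<Rightarrow> 'c rel \<Rightarrow> bool" where
  "has_dimension K V \<kappa> \<longleftrightarrow> (\<exists>B. is_basis K V B \<and> |B| =o \<kappa>)"

text \<open>
  The product \<open>r \<otimes> s\<close> means: apply \<open>r\<close> first, then \<open>s\<close>. With this convention a surjective
  endomorphism is left invertible. Endomorphisms are \<open>undefined\<close> outside the carrier, so that
  equality of ring elements is equality of endomorphisms.
\<close>

definition endo_ring :: "('a, 'x) ring_scheme \<Rightarrow> ('a, 'v) module \<Rightarrow> ('v \<Rightarrow> 'v) ring" where
  "endo_ring K V =
     \<lparr>carrier = mod_hom K V V \<inter> extensional (carrier V),
      mult = (\<lambda>r s. compose (carrier V) s r),
      one = (\<lambda>v\<in>carrier V. v),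
      zero = (\<lambda>v\<in>carrier V. \<zero>\<^bsub>V\<^esub>),
      add = (\<lambda>r s. \<lambda>v\<in>carrier V. r v \<oplus>\<^bsub>V\<^esub> s v)\<rparr>"

section \<open>Independence of the chosen types\<close>

definition free_right_module ::
  "('a, 'x) ring_scheme \<Rightarrow> 'i set \<Rightarrow> ('a, 'i \<Rightarrow> 'a) module" where
  "free_right_module R A =
     \<lparr>carrier = {c. (\<forall>i. c i \<in> carrier R) \<and> finite {i. c i \<noteq> \<zero>\<^bsub>R\<^esub>} \<and> {i. c i \<noteq> \<zero>\<^bsub>R\<^esub>} \<subseteq> A},
      mult = undefined, one = undefined, zero = (\<lambda>i. \<zero>\<^bsub>R\<^esub>), add = (\<lambda>c d i. c i \<oplus>\<^bsub>R\<^esub> d i),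
      smult = (\<lambda>a c i. c i \<otimes>\<^bsub>R\<^esub> a)\<rparr>"

definition lin_comb ::
  "('a, 'x) ring_scheme \<Rightarrow> ('a, 'b) module \<Rightarrow> ('i \<Rightarrow> 'b) \<Rightarrow> ('i \<Rightarrow> 'a) \<Rightarrow> 'b" where
  "lin_comb R M g c = (\<Oplus>\<^bsub>M\<^esub>i\<in>{i. c i \<noteq> \<zero>\<^bsub>R\<^esub>}. g i \<triangleleft>\<^bsub>M\<^esub> c i)"

lemma mod_homD:
  assumes "f \<in> mod_hom R M N"
  shows "x \<in> carrier M \<Longrightarrow> f x \<in> carrier N"
    and "x \<in> carrier M \<Longrightarrow> y \<in> carrier M \<Longrightarrow> f (x \<oplus>\<^bsub>M\<^esub> y) = f x \<oplus>\<^bsub>N\<^esub> f y"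
    and "x \<in> carrier M \<Longrightarrow> a \<in> carrier R \<Longrightarrow> f (a \<odot>\<^bsub>M\<^esub> x) = a \<odot>\<^bsub>N\<^esub> f x"
  using assms unfolding mod_hom_def by auto

lemma mod_hom_comp:
  assumes "f \<in> mod_hom R M N" "g \<in> mod_hom R N P"
  shows "(\<lambda>x. g (f x)) \<in> mod_hom R M P"
  using assms unfolding mod_hom_def by (auto simp: Pi_iff)

lemma mod_hom_zero:
  assumes "right_module R M" "right_module R N" "f \<in> mod_hom R M N"
  shows "f \<zero>\<^bsub>M\<^esub> = \<zero>\<^bsub>N\<^esub>"
proof -
  interpret M: right_module R M by fact
  interpret N: right_module R N by fact
  have "f \<zero>\<^bsub>M\<^esub> \<oplus>\<^bsub>N\<^esub> f \<zero>\<^bsub>M\<^esub> = f \<zero>\<^bsub>M\<^esub>"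
    using mod_homD(2)[OF assms(3), of "\<zero>\<^bsub>M\<^esub>" "\<zero>\<^bsub>M\<^esub>"] by simp
  then show ?thesis
    using mod_homD(1)[OF assms(3), of "\<zero>\<^bsub>M\<^esub>"] by (metis M.M.zero_closed N.M.add.r_cancel_one')
qed

lemma mod_hom_uminus:
  assumes "right_module R M" "right_module R N" "f \<in> mod_hom R M N" "x \<in> carrier M"
  shows "f (\<ominus>\<^bsub>M\<^esub> x) = \<ominus>\<^bsub>N\<^esub> f x"
proof -
  interpret M: right_module R M by fact
  interpret N: right_module R N by fact
  have "f (\<ominus>\<^bsub>M\<^esub> x) \<oplus>\<^bsub>N\<^esub> f x = \<zero>\<^bsub>N\<^esub>"
    using mod_homD(2)[OF assms(3), of "\<ominus>\<^bsub>M\<^esub> x" x] assms(4) mod_hom_zero[OF assms(1-3)]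
    by (simp add: M.M.l_neg)
  then show ?thesis
    using mod_homD(1)[OF assms(3)] assms(4) by (metis M.M.a_inv_closed N.M.minus_equality)
qed

lemma (in right_module) sub_rmoduleI:
  assumes "H \<subseteq> carrier M" "\<zero>\<^bsub>M\<^esub> \<in> H"
    and "\<And>x. x \<in> H \<Longrightarrow> \<ominus>\<^bsub>M\<^esub> x \<in> H"
    and "\<And>x y. \<lbrakk>x \<in> H; y \<in> H\<rbrakk> \<Longrightarrow> x \<oplus>\<^bsub>M\<^esub> y \<in> H"
    and "\<And>a x. \<lbrakk>a \<in> carrier R; x \<in> H\<rbrakk> \<Longrightarrow> x \<triangleleft>\<^bsub>M\<^esub> a \<in> H"
  shows "submodule H R M"
  using assms by (intro submodule.intro subgroup.intro) (auto simp: submodule_axioms_def a_inv_def)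

lemma (in right_module) sub_rmoduleD:
  assumes "submodule H R M"
  shows "H \<subseteq> carrier M" "\<zero>\<^bsub>M\<^esub> \<in> H"
    and "\<And>x. x \<in> H \<Longrightarrow> \<ominus>\<^bsub>M\<^esub> x \<in> H"
    and "\<And>x y. \<lbrakk>x \<in> H; y \<in> H\<rbrakk> \<Longrightarrow> x \<oplus>\<^bsub>M\<^esub> y \<in> H"
    and "\<And>a x. \<lbrakk>a \<in> carrier R; x \<in> H\<rbrakk> \<Longrightarrow> x \<triangleleft>\<^bsub>M\<^esub> a \<in> H"
proof -
  interpret submodule H R M by fact
  show "H \<subseteq> carrier M" using subset by simp
  show "\<zero>\<^bsub>M\<^esub> \<in> H" using one_closed by simp
  show "\<And>x. x \<in> H \<Longrightarrow> \<ominus>\<^bsub>M\<^esub> x \<in> H" using m_inv_closed unfolding a_inv_def by simp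
  show "\<And>x y. \<lbrakk>x \<in> H; y \<in> H\<rbrakk> \<Longrightarrow> x \<oplus>\<^bsub>M\<^esub> y \<in> H" using m_closed by simp
  show "\<And>a x. \<lbrakk>a \<in> carrier R; x \<in> H\<rbrakk> \<Longrightarrow> x \<triangleleft>\<^bsub>M\<^esub> a \<in> H" using smult_closed by simp
qed

lemma submodule_image:
  assumes "right_module R M" "right_module R N" "f \<in> mod_hom R M N" "submodule H R M"
  shows "submodule (f ` H) R N"
proof -
  interpret M: right_module R M by fact
  interpret N: right_module R N by fact
  note H = M.sub_rmoduleD[OF assms(4)]
  show ?thesis
  proof (rule N.sub_rmoduleI)
    show "f ` H \<subseteq> carrier N" using H(1) mod_homD(1)[OF assms(3)] by auto
    show "\<zero>\<^bsub>N\<^esub> \<in> f ` H" using H(2) mod_hom_zero[OF assms(1-3)] by (metis imageI)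
    show "\<ominus>\<^bsub>N\<^esub> y \<in> f ` H" if "y \<in> f ` H" for y
    proof -
      from that obtain u where "u \<in> H" "y = f u" by blast
      then have "\<ominus>\<^bsub>N\<^esub> y = f (\<ominus>\<^bsub>M\<^esub> u)" "\<ominus>\<^bsub>M\<^esub> u \<in> H"
        using H(1) H(3)[of u] mod_hom_uminus[OF assms(1-3), of u] by auto
      then show ?thesis by (metis imageI)
    qed
    show "x \<oplus>\<^bsub>N\<^esub> y \<in> f ` H" if "x \<in> f ` H" "y \<in> f ` H" for x y
    proof -
      from that obtain u v where "u \<in> H" "v \<in> H" "x = f u" "y = f v" by blast
      then have "x \<oplus>\<^bsub>N\<^esub> y = f (u \<oplus>\<^bsub>M\<^esub> v)" "u \<oplus>\<^bsub>M\<^esub> v \<in> H"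
        using H(4)[of u v] mod_homD(2)[OF assms(3), of u v] subsetD[OF H(1), of u]
          subsetD[OF H(1), of v] by auto
      then show ?thesis by (metis imageI)
    qed
    show "x \<triangleleft>\<^bsub>N\<^esub> a \<in> f ` H" if "a \<in> carrier R" "x \<in> f ` H" for a x
    proof -
      from that obtain u where "u \<in> H" "x = f u" by blast
      then have "x \<triangleleft>\<^bsub>N\<^esub> a = f (u \<triangleleft>\<^bsub>M\<^esub> a)" "u \<triangleleft>\<^bsub>M\<^esub> a \<in> H"
        using that(1) H(1) H(5)[of a u] mod_homD(3)[OF assms(3), of u a] by auto
      then show ?thesis by (metis imageI)
    qed
  qed
qed

lemma (in right_module) carrier_submodule: "submodule (carrier M) R M"
  by (rule sub_rmoduleI) auto

lemma (in right_module) rsmult_zero_scalar [simp]: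
  assumes "x \<in> carrier M" shows "x \<triangleleft>\<^bsub>M\<^esub> \<zero> = \<zero>\<^bsub>M\<^esub>"
  using rsmult_add_scalar[OF assms, of \<zero> \<zero>] assms
  by (metis M.add.r_cancel_one' R.zero_closed R.l_zero rsmult_closed)

lemma (in right_module) rsmult_zero_vector [simp]:
  assumes "a \<in> carrier R" shows "\<zero>\<^bsub>M\<^esub> \<triangleleft>\<^bsub>M\<^esub> a = \<zero>\<^bsub>M\<^esub>"
  using rsmult_add_vector[of "\<zero>\<^bsub>M\<^esub>" "\<zero>\<^bsub>M\<^esub>" a] assms
  by (metis M.add.r_cancel_one' M.zero_closed M.l_zero rsmult_closed)

lemma mod_hom_finsum:
  assumes "right_module R M" "right_module R N" "f \<in> mod_hom R M N" "finite S" "h \<in> S \<rightarrow> carrier M"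
  shows "f (\<Oplus>\<^bsub>M\<^esub>i\<in>S. h i) = (\<Oplus>\<^bsub>N\<^esub>i\<in>S. f (h i))"
proof -
  interpret M: right_module R M by fact
  interpret N: right_module R N by fact
  show ?thesis using assms(4,5)
  proof (induction S)
    case empty
    then show ?case using mod_hom_zero[OF assms(1-3)] by simp
  next
    case (insert i S)
    then have h: "h \<in> S \<rightarrow> carrier M" "h i \<in> carrier M" by auto
    then have "f (h i) \<in> carrier N" "(\<lambda>i. f (h i)) \<in> S \<rightarrow> carrier N"
      using mod_homD(1)[OF assms(3)] by auto
    then show ?case
      using insert h mod_homD(2)[OF assms(3) h(2) M.M.finsum_closed[OF h(1)]] by simp
  qed
qed

lemma free_right_module:
  assumes "ring R" shows "right_module R (free_right_module R A)"
proof -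
  interpret R: ring R by fact
  have fin: "finite {i. c i \<oplus>\<^bsub>R\<^esub> d i \<noteq> \<zero>\<^bsub>R\<^esub>} \<and> {i. c i \<oplus>\<^bsub>R\<^esub> d i \<noteq> \<zero>\<^bsub>R\<^esub>} \<subseteq> A"
    if "finite {i. c i \<noteq> \<zero>\<^bsub>R\<^esub>}" "{i. c i \<noteq> \<zero>\<^bsub>R\<^esub>} \<subseteq> A"
      "finite {i. d i \<noteq> \<zero>\<^bsub>R\<^esub>}" "{i. d i \<noteq> \<zero>\<^bsub>R\<^esub>} \<subseteq> A" for c d
  proof -
    have "{i. c i \<oplus>\<^bsub>R\<^esub> d i \<noteq> \<zero>\<^bsub>R\<^esub>} \<subseteq> {i. c i \<noteq> \<zero>\<^bsub>R\<^esub>} \<union> {i. d i \<noteq> \<zero>\<^bsub>R\<^esub>}" by auto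
    then show ?thesis using that by (meson Un_least finite_UnI finite_subset subset_trans)
  qed
  have fin_smult: "finite {i. c i \<otimes>\<^bsub>R\<^esub> a \<noteq> \<zero>\<^bsub>R\<^esub>} \<and> {i. c i \<otimes>\<^bsub>R\<^esub> a \<noteq> \<zero>\<^bsub>R\<^esub>} \<subseteq> A"
    if "finite {i. c i \<noteq> \<zero>\<^bsub>R\<^esub>}" "{i. c i \<noteq> \<zero>\<^bsub>R\<^esub>} \<subseteq> A" "a \<in> carrier R" for c a
  proof -
    have "{i. c i \<otimes>\<^bsub>R\<^esub> a \<noteq> \<zero>\<^bsub>R\<^esub>} \<subseteq> {i. c i \<noteq> \<zero>\<^bsub>R\<^esub>}" using that by auto
    then show ?thesis using that by (meson finite_subset subset_trans)
  qed
  have neg: "{i. \<ominus>\<^bsub>R\<^esub> c i \<noteq> \<zero>\<^bsub>R\<^esub>} = {i. c i \<noteq> \<zero>\<^bsub>R\<^esub>}" if "\<forall>i. c i \<in> carrier R" for c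
    using that by (metis R.minus_minus R.minus_zero)
  show ?thesis
  proof (intro right_module.intro abelian_groupI right_module_axioms.intro)
    show "ring R" by fact
    show "\<exists>y\<in>carrier (free_right_module R A).
        y \<oplus>\<^bsub>free_right_module R A\<^esub> x = \<zero>\<^bsub>free_right_module R A\<^esub>"
      if "x \<in> carrier (free_right_module R A)" for x
      using that neg[of x] unfolding free_right_module_def
      by (intro bexI[where x = "\<lambda>i. \<ominus>\<^bsub>R\<^esub> x i"]) (auto simp: R.l_neg)
  qed (use fin fin_smult in \<open>auto simp: free_right_module_def R.a_assoc R.a_comm R.a_lcomm R.m_assoc R.l_distr R.r_distr\<close>)
qed

lemma lin_comb_superset:
  assumes "right_module R M" "g \<in> A \<rightarrow> carrier M" "c \<in> carrier (free_right_module R A)"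
    "finite S" "{i. c i \<noteq> \<zero>\<^bsub>R\<^esub>} \<subseteq> S" "S \<subseteq> A"
  shows "lin_comb R M g c = (\<Oplus>\<^bsub>M\<^esub>i\<in>S. g i \<triangleleft>\<^bsub>M\<^esub> c i)"
proof -
  interpret M: right_module R M by fact
  show ?thesis unfolding lin_comb_def
    using assms(2-6)
    by (intro M.M.add.finprod_mono_neutral_cong_left) (auto simp: free_right_module_def Pi_iff)
qed

lemma lin_comb_hom:
  fixes M :: "('a, 'b) module" and g :: "'i \<Rightarrow> 'b"
  assumes "right_module R M" "g \<in> A \<rightarrow> carrier M"
  shows "lin_comb R M g \<in> mod_hom R (free_right_module R A) M"
proof -
  interpret M: right_module R M by fact
  let ?F = "free_right_module R A"
  let ?s = "\<lambda>c. {i. c i \<noteq> \<zero>\<^bsub>R\<^esub>}"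
  interpret F: right_module R ?F by (rule free_right_module) (rule M.R.ring_axioms)
  have F: "c i \<in> carrier R" "finite (?s c)" "?s c \<subseteq> A" if "c \<in> carrier ?F" for c i
    using that by (auto simp: free_right_module_def)
  have g: "g i \<in> carrier M" if "i \<in> A" for i using assms(2) that by auto
  have closed: "lin_comb R M g c \<in> carrier M" if "c \<in> carrier ?F" for c
    unfolding lin_comb_def using F[OF that] g by (intro M.M.finsum_closed) auto
  moreover have "lin_comb R M g (c \<oplus>\<^bsub>?F\<^esub> d) = lin_comb R M g c \<oplus>\<^bsub>M\<^esub> lin_comb R M g d"
    if c: "c \<in> carrier ?F" and d: "d \<in> carrier ?F" for c d
  proof -
    let ?S = "?s c \<union> ?s d"
    have S: "finite ?S" "?S \<subseteq> A" using F[OF c] F[OF d] by auto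
    have cd: "(c \<oplus>\<^bsub>?F\<^esub> d) i = c i \<oplus>\<^bsub>R\<^esub> d i" for i by (simp add: free_right_module_def)
    have "lin_comb R M g (c \<oplus>\<^bsub>?F\<^esub> d) = (\<Oplus>\<^bsub>M\<^esub>i\<in>?S. g i \<triangleleft>\<^bsub>M\<^esub> (c \<oplus>\<^bsub>?F\<^esub> d) i)"
      by (rule lin_comb_superset[OF assms]) (use c d S in \<open>auto simp: cd\<close>)
    also have "\<dots> = (\<Oplus>\<^bsub>M\<^esub>i\<in>?S. g i \<triangleleft>\<^bsub>M\<^esub> c i \<oplus>\<^bsub>M\<^esub> g i \<triangleleft>\<^bsub>M\<^esub> d i)"
      using S g F(1)[OF c] F(1)[OF d]
      by (intro M.M.finsum_cong') (auto simp: cd M.rsmult_add_scalar subset_iff)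
    also have "\<dots> = (\<Oplus>\<^bsub>M\<^esub>i\<in>?S. g i \<triangleleft>\<^bsub>M\<^esub> c i) \<oplus>\<^bsub>M\<^esub> (\<Oplus>\<^bsub>M\<^esub>i\<in>?S. g i \<triangleleft>\<^bsub>M\<^esub> d i)"
      using S g F(1)[OF c] F(1)[OF d] by (intro M.M.finsum_addf) auto
    also have "\<dots> = lin_comb R M g c \<oplus>\<^bsub>M\<^esub> lin_comb R M g d"
      using lin_comb_superset[OF assms c S(1) _ S(2)] lin_comb_superset[OF assms d S(1) _ S(2)]
      by auto
    finally show ?thesis .
  qed
  moreover have "lin_comb R M g (a \<odot>\<^bsub>?F\<^esub> c) = a \<odot>\<^bsub>M\<^esub> lin_comb R M g c"
    if c: "c \<in> carrier ?F" and a: "a \<in> carrier R" for c a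
  proof -
    have ac: "(a \<odot>\<^bsub>?F\<^esub> c) i = c i \<otimes>\<^bsub>R\<^esub> a" for i by (simp add: free_right_module_def)
    have sum: "(\<Oplus>\<^bsub>M\<^esub>i\<in>S. h i) \<triangleleft>\<^bsub>M\<^esub> a = (\<Oplus>\<^bsub>M\<^esub>i\<in>S. h i \<triangleleft>\<^bsub>M\<^esub> a)"
      if "finite S" "h \<in> S \<rightarrow> carrier M" for S and h :: "'i \<Rightarrow> 'b"
      using that
    proof (induction S)
      case (insert i S)
      then have h: "h \<in> S \<rightarrow> carrier M" "h i \<in> carrier M" by auto
      then have "(\<lambda>i. h i \<triangleleft>\<^bsub>M\<^esub> a) \<in> S \<rightarrow> carrier M" using a by auto
      then show ?case
        using insert h a by (simp add: M.rsmult_add_vector)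
    qed (use a in simp)
    have "lin_comb R M g (a \<odot>\<^bsub>?F\<^esub> c) = (\<Oplus>\<^bsub>M\<^esub>i\<in>?s c. g i \<triangleleft>\<^bsub>M\<^esub> (a \<odot>\<^bsub>?F\<^esub> c) i)"
      by (rule lin_comb_superset[OF assms]) (use c a F[OF c] in \<open>auto simp: ac\<close>)
    also have "\<dots> = (\<Oplus>\<^bsub>M\<^esub>i\<in>?s c. (g i \<triangleleft>\<^bsub>M\<^esub> c i) \<triangleleft>\<^bsub>M\<^esub> a)"
      using a F[OF c] g by (intro M.M.finsum_cong') (auto simp: ac M.rsmult_assoc subset_iff)
    also have "\<dots> = lin_comb R M g c \<triangleleft>\<^bsub>M\<^esub> a"
      unfolding lin_comb_def using F[OF c] g by (intro sum[symmetric]) auto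
    finally show ?thesis .
  qed
  ultimately show ?thesis by (auto simp: mod_hom_def)
qed

lemma lin_comb_unit:
  assumes "right_module R M" "g \<in> A \<rightarrow> carrier M" "i \<in> A"
  shows "\<exists>c \<in> carrier (free_right_module R A). lin_comb R M g c = g i"
proof -
  interpret M: right_module R M by fact
  let ?c = "\<lambda>j. if j = i then \<one>\<^bsub>R\<^esub> else \<zero>\<^bsub>R\<^esub>"
  have c: "?c \<in> carrier (free_right_module R A)"
    using assms(3) finite_subset[of "{j. ?c j \<noteq> \<zero>\<^bsub>R\<^esub>}" "{i}"]
    by (auto simp: free_right_module_def split: if_splits)
  have "lin_comb R M g ?c = (\<Oplus>\<^bsub>M\<^esub>j\<in>{i}. g j \<triangleleft>\<^bsub>M\<^esub> ?c j)"
    by (rule lin_comb_superset[OF assms(1,2) c]) (use assms(3) in auto)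
  also have "\<dots> = g i" using assms(2,3) by (auto simp: Pi_iff)
  finally show ?thesis using c by blast
qed

lemma mod_hom_lin_comb:
  assumes "right_module R M" "right_module R N" "f \<in> mod_hom R M N" "g \<in> A \<rightarrow> carrier M"
    "c \<in> carrier (free_right_module R A)"
  shows "f (lin_comb R M g c) = lin_comb R N (\<lambda>i. f (g i)) c"
proof -
  interpret M: right_module R M by fact
  interpret N: right_module R N by fact
  have c: "c i \<in> carrier R" "finite {i. c i \<noteq> \<zero>\<^bsub>R\<^esub>}" "{i. c i \<noteq> \<zero>\<^bsub>R\<^esub>} \<subseteq> A" for i
    using assms(5) by (auto simp: free_right_module_def)
  have "f (lin_comb R M g c) = (\<Oplus>\<^bsub>N\<^esub>i\<in>{i. c i \<noteq> \<zero>\<^bsub>R\<^esub>}. f (g i \<triangleleft>\<^bsub>M\<^esub> c i))"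
    unfolding lin_comb_def using c assms(4)
    by (intro mod_hom_finsum[OF assms(1-3)]) auto
  also have "\<dots> = lin_comb R N (\<lambda>i. f (g i)) c"
    unfolding lin_comb_def using c assms(4) mod_homD(1,3)[OF assms(3)]
    by (intro N.M.finsum_cong') (auto simp: Pi_iff subset_iff)
  finally show ?thesis .
qed

lemma projective_lift:
  fixes M :: "('a, 'b) module" and N :: "('a, 'n) module" and P :: "('a, 'p) module"
  assumes M: "projective R M" and N: "right_module R N" and P: "right_module R P"
    and p: "p \<in> mod_hom R N P" "p ` carrier N = carrier P" and f: "f \<in> mod_hom R M P"
  shows "\<exists>g \<in> mod_hom R M N. \<forall>x\<in>carrier M. p (g x) = f x"
proof -
  have rM: "right_module R M" using M by (simp add: projective_def)
  interpret M: right_module R M by fact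
  let ?F = "free_right_module R (carrier M)"
  let ?e = "lin_comb R M (\<lambda>x. x)"
  have rF: "right_module R ?F" by (rule free_right_module) (rule M.R.ring_axioms)
  have e: "?e \<in> mod_hom R ?F M" by (rule lin_comb_hom[OF rM]) auto
  have surj: "?e ` carrier ?F = carrier M"
    using mod_homD(1)[OF e] lin_comb_unit[OF rM, of "\<lambda>x. x" "carrier M"] by force
  have id: "(\<lambda>x. x) \<in> mod_hom R M M" by (auto simp: mod_hom_def)
  have "\<forall>f\<in>mod_hom R M M. \<exists>g\<in>mod_hom R M ?F. \<forall>x\<in>carrier M. ?e (g x) = f x"
    using M rF rM e surj by (simp add: projective_def)
  from bspec[OF this id] obtain s
    where s: "s \<in> mod_hom R M ?F" "\<And>x. x \<in> carrier M \<Longrightarrow> ?e (s x) = x" by auto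
  have "\<forall>x\<in>carrier M. \<exists>y\<in>carrier N. p y = f x"
    using mod_homD(1)[OF f] p(2) by (metis imageE)
  then obtain n where n: "\<And>x. x \<in> carrier M \<Longrightarrow> n x \<in> carrier N \<and> p (n x) = f x" by metis
  have nA: "n \<in> carrier M \<rightarrow> carrier N" using n by auto
  have eq: "p (lin_comb R N n (s x)) = f x" if x: "x \<in> carrier M" for x
  proof -
    have sx: "s x \<in> carrier ?F" using mod_homD(1)[OF s(1) x] .
    then have supp: "{i. s x i \<noteq> \<zero>\<^bsub>R\<^esub>} \<subseteq> carrier M" "\<And>i. s x i \<in> carrier R"
      by (auto simp: free_right_module_def)
    interpret P: right_module R P by fact
    have "p (lin_comb R N n (s x)) = lin_comb R P (\<lambda>i. p (n i)) (s x)"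
      by (rule mod_hom_lin_comb[OF N P p(1) nA sx])
    also have "\<dots> = lin_comb R P f (s x)"
      unfolding lin_comb_def using supp n mod_homD(1)[OF f]
      by (intro P.M.finsum_cong') (auto simp: subset_iff)
    also have "\<dots> = f (?e (s x))"
      by (rule mod_hom_lin_comb[OF rM P f _ sx, symmetric]) auto
    finally show ?thesis using s(2) x by simp
  qed
  show ?thesis
    by (rule bexI[OF _ mod_hom_comp[OF s(1) lin_comb_hom[OF N nA]]]) (simp add: eq)
qed

definition mod_iso ::
  "('a, 'x) ring_scheme \<Rightarrow> ('a, 'b) module \<Rightarrow> ('a, 'c) module \<Rightarrow> ('b \<Rightarrow> 'c) \<Rightarrow> ('c \<Rightarrow> 'b) \<Rightarrow> bool" where
  "mod_iso R M N \<phi> \<psi> \<longleftrightarrow> right_module R M \<and> right_module R N \<and>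
     \<phi> \<in> mod_hom R M N \<and> \<psi> \<in> mod_hom R N M \<and>
     (\<forall>x\<in>carrier M. \<psi> (\<phi> x) = x) \<and> (\<forall>y\<in>carrier N. \<phi> (\<psi> y) = y)"

lemma mod_iso_sym: "mod_iso R M N \<phi> \<psi> \<Longrightarrow> mod_iso R N M \<psi> \<phi>"
  by (auto simp: mod_iso_def)

lemma inj_imp_mod_iso:
  fixes M :: "('a, 'b) module" and \<phi> :: "'b \<Rightarrow> 'c"
  assumes M: "right_module R M" and inj: "inj_on \<phi> (carrier M)"
  shows "\<exists>(N :: ('a, 'c) module) \<psi>. mod_iso R M N \<phi> \<psi>"
proof -
  interpret M: right_module R M by fact
  let ?psi = "inv_into (carrier M) \<phi>"
  define N :: "('a, 'c) module" where "N =
     \<lparr>carrier = \<phi> ` carrier M, mult = undefined, one = undefined, zero = \<phi> \<zero>\<^bsub>M\<^esub>,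
      add = (\<lambda>x y. \<phi> (?psi x \<oplus>\<^bsub>M\<^esub> ?psi y)), smult = (\<lambda>a x. \<phi> (?psi x \<triangleleft>\<^bsub>M\<^esub> a))\<rparr>"
  have psi [simp]: "?psi (\<phi> x) = x" if "x \<in> carrier M" for x using inj that by simp
  have "abelian_group N"
  proof (rule abelian_groupI)
    show "\<exists>y\<in>carrier N. y \<oplus>\<^bsub>N\<^esub> x = \<zero>\<^bsub>N\<^esub>" if "x \<in> carrier N" for x
    proof -
      from that obtain m where "m \<in> carrier M" "x = \<phi> m" by (auto simp: N_def)
      then show ?thesis
        by (intro bexI[of _ "\<phi> (\<ominus>\<^bsub>M\<^esub> m)"]) (auto simp: N_def M.M.l_neg)
    qed
  qed (auto simp: N_def M.M.a_assoc M.M.a_comm M.M.a_lcomm)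
  then have "right_module R N"
    by (intro right_module.intro M.R.ring_axioms right_module_axioms.intro)
      (auto simp: N_def M.rsmult_add_scalar M.rsmult_add_vector M.rsmult_assoc)
  then have "mod_iso R M N \<phi> ?psi"
    using M by (auto simp: mod_iso_def mod_hom_def N_def)
  then show ?thesis by blast
qed

lemma mod_iso_projective:
  fixes M :: "('a, 'b) module" and N :: "('a, 'c) module"
  assumes iso: "mod_iso R M N \<phi> \<psi>" and M: "projective R M"
  shows "projective R N"
proof -
  have h: "\<phi> \<in> mod_hom R M N" "\<psi> \<in> mod_hom R N M" "right_module R N"
    "\<And>y. y \<in> carrier N \<Longrightarrow> \<phi> (\<psi> y) = y"
    using iso by (auto simp: mod_iso_def)
  show ?thesis unfolding projective_def
  proof (intro conjI allI impI ballI)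
    fix A :: "('a, 'c \<Rightarrow> 'a) module" and P :: "('a, 'c) module" and p f
    assume "right_module R A \<and> right_module R P"
    then have a: "right_module R A" "right_module R P" by auto
    assume b: "p \<in> mod_hom R A P"
      "p ` carrier A = carrier P" "f \<in> mod_hom R N P"
    obtain g where g: "g \<in> mod_hom R M A" "\<forall>x\<in>carrier M. p (g x) = f (\<phi> x)"
      using projective_lift[OF M a b(1,2) mod_hom_comp[OF h(1) b(3)]] by auto
    show "\<exists>g\<in>mod_hom R N A. \<forall>x\<in>carrier N. p (g x) = f x"
      using mod_hom_comp[OF h(2) g(1)] g(2) h(4) mod_homD(1)[OF h(2)]
      by (intro bexI[of _ "\<lambda>y. g (\<psi> y)"]) auto
  qed (rule h(3))
qed

lemma mod_iso_R_projective:
  assumes iso: "mod_iso R M N \<phi> \<psi>" and M: "R_projective R M"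
  shows "R_projective R N"
proof -
  have h: "\<phi> \<in> mod_hom R M N" "\<psi> \<in> mod_hom R N M" "right_module R N"
    "\<And>y. y \<in> carrier N \<Longrightarrow> \<phi> (\<psi> y) = y"
    using iso by (auto simp: mod_iso_def)
  show ?thesis unfolding R_projective_def
  proof (intro conjI allI impI ballI)
    fix I f
    assume a: "right_ideal I R" "f \<in> mod_hom R N (quotient_right_module (regular_right_module R) I)"
    have "\<forall>f \<in> mod_hom R M (quotient_right_module (regular_right_module R) I).
        \<exists>g \<in> mod_hom R M (regular_right_module R). \<forall>x\<in>carrier M. f x = I +>\<^bsub>R\<^esub> g x"
      using M a(1) by (simp add: R_projective_def)
    from bspec[OF this mod_hom_comp[OF h(1) a(2)]]
    obtain g where g: "g \<in> mod_hom R M (regular_right_module R)"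
        "\<forall>x\<in>carrier M. f (\<phi> x) = I +>\<^bsub>R\<^esub> g x"
      by (elim bexE)
    show "\<exists>g\<in>mod_hom R N (regular_right_module R). \<forall>x\<in>carrier N. f x = I +>\<^bsub>R\<^esub> g x"
    proof (rule bexI[OF _ mod_hom_comp[OF h(2) g(1)]], rule ballI)
      fix y assume y: "y \<in> carrier N"
      show "f y = I +>\<^bsub>R\<^esub> g (\<psi> y)"
        using bspec[OF g(2) mod_homD(1)[OF h(2) y]] h(4)[OF y] by simp
    qed
  qed (rule h(3))
qed

lemma mod_iso_generated:
  assumes iso: "mod_iso R M N \<phi> \<psi>" and M: "generated_by_at_most R M \<kappa>"
  shows "generated_by_at_most R N \<kappa>"
proof -
  have h: "\<phi> \<in> mod_hom R M N" "\<psi> \<in> mod_hom R N M" "right_module R M" "right_module R N"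
    "\<And>x. x \<in> carrier M \<Longrightarrow> \<psi> (\<phi> x) = x" "\<And>y. y \<in> carrier N \<Longrightarrow> \<phi> (\<psi> y) = y"
    using iso by (auto simp: mod_iso_def)
  obtain X where X: "generates R M X" "|X| \<le>o \<kappa>"
    using M by (auto simp: generated_by_at_most_def)
  then have XM: "X \<subseteq> carrier M" by (simp add: generates_def)
  have "generates R N (\<phi> ` X)" unfolding generates_def
  proof (intro conjI allI impI)
    show "\<phi> ` X \<subseteq> carrier N" using XM mod_homD(1)[OF h(1)] by auto
    fix L assume L: "submodule L R N \<and> \<phi> ` X \<subseteq> L"
    then have LN: "L \<subseteq> carrier N" using right_module.sub_rmoduleD(1)[OF h(4)] by blast
    have "submodule (\<psi> ` L) R M" using submodule_image[OF h(4,3,2)] L by blast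
    moreover have "X \<subseteq> \<psi> ` L"
    proof
      fix x assume x: "x \<in> X"
      then have "\<phi> x \<in> L" "\<psi> (\<phi> x) = x" using L XM h(5) by auto
      then show "x \<in> \<psi> ` L" by (metis imageI)
    qed
    ultimately have "\<psi> ` L = carrier M" using X(1) unfolding generates_def by blast
    have "y \<in> L" if y: "y \<in> carrier N" for y
    proof -
      obtain l where l: "l \<in> L" "\<psi> y = \<psi> l"
        using mod_homD(1)[OF h(2) y] \<open>\<psi> ` L = carrier M\<close> by blast
      then have "y = l" using h(6)[OF y] h(6)[of l] LN by auto
      then show ?thesis using l(1) by simp
    qed
    then show "L = carrier N" using LN by auto
  qed
  moreover have "|\<phi> ` X| \<le>o \<kappa>" by (rule ordLeq_transitive[OF card_of_image X(2)])
  ultimately show ?thesis by (auto simp: generated_by_at_most_def)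
qed

lemma generated_small_copy:
  fixes M :: "('a, 'b) module" and \<kappa> :: "'c rel"
  assumes M: "right_module R M" and \<kappa>: "Card_order \<kappa>" and gen: "generated_by_at_most R M \<kappa>"
  shows "\<exists>(N :: ('a, ('c \<Rightarrow> 'a) set) module) \<phi> \<psi>. mod_iso R M N \<phi> \<psi>"
proof -
  interpret M: right_module R M by fact
  obtain X where X: "generates R M X" "|X| \<le>o \<kappa>"
    using gen by (auto simp: generated_by_at_most_def)
  then have XM: "X \<subseteq> carrier M" by (simp add: generates_def)
  have "|X| \<le>o |Field \<kappa>|"
    by (rule ordLeq_ordIso_trans[OF X(2) ordIso_symmetric[OF card_of_Field_ordIso[OF \<kappa>]]])
  then obtain h :: "'b \<Rightarrow> 'c" where h: "inj_on h X" by (auto simp: card_of_ordLeq[symmetric])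
  let ?g = "inv_into X h"
  let ?A = "h ` X"
  let ?F = "free_right_module R ?A"
  have g: "?g \<in> ?A \<rightarrow> carrier M" using XM h by auto
  have F: "right_module R ?F" by (rule free_right_module) (rule M.R.ring_axioms)
  note e = lin_comb_hom[OF M g]
  have "submodule (lin_comb R M ?g ` carrier ?F) R M"
    by (rule submodule_image[OF F M e]) (rule right_module.carrier_submodule[OF F])
  moreover have "X \<subseteq> lin_comb R M ?g ` carrier ?F"
  proof
    fix x assume "x \<in> X"
    then show "x \<in> lin_comb R M ?g ` carrier ?F"
      using lin_comb_unit[OF M g, of "h x"] h by (auto simp: image_iff)
  qed
  ultimately have surj: "lin_comb R M ?g ` carrier ?F = carrier M"
    using X(1) unfolding generates_def by blast
  let ?phi = "\<lambda>x. {c \<in> carrier ?F. lin_comb R M ?g c = x}"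
  have "inj_on ?phi (carrier M)"
  proof (rule inj_onI)
    fix x y assume x: "x \<in> carrier M" and eq: "?phi x = ?phi y"
    from x surj have "x \<in> lin_comb R M ?g ` carrier ?F" by simp
    then obtain c where c: "x = lin_comb R M ?g c" "c \<in> carrier ?F" by (rule imageE)
    then have "c \<in> ?phi x" by simp
    then have "c \<in> ?phi y" by (simp only: eq)
    then show "x = y" using c(1) by simp
  qed
  from inj_imp_mod_iso[OF M this] show ?thesis by (elim exE) (intro exI)
qed

text \<open>
  A ring-theoretic statement about all modules with at most \<open>\<kappa>\<close> generators, where \<open>\<kappa>\<close> is a
  cardinal on the type \<open>'c\<close>, may be tested on modules with elements of type \<open>('c \<Rightarrow> 'a) set\<close>.
\<close>

lemma generated_universe:
  fixes R :: "('a, 'x) ring_scheme" and \<kappa> :: "'c rel" and M :: "('a, 'b) module"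
  assumes "\<forall>N :: ('a, ('c \<Rightarrow> 'a) set) module. right_module R N \<and> generated_by_at_most R N \<kappa> \<longrightarrow>
      (projective R N \<longleftrightarrow> R_projective R N)"
    and "Card_order \<kappa>" "right_module R M" "generated_by_at_most R M \<kappa>"
  shows "projective R M \<longleftrightarrow> R_projective R M"
proof -
  obtain N :: "('a, ('c \<Rightarrow> 'a) set) module" and \<phi> \<psi> where iso: "mod_iso R M N \<phi> \<psi>"
    using generated_small_copy[OF assms(3,2,4)] by (elim exE)
  then have "right_module R N" by (simp add: mod_iso_def)
  then have eq: "projective R N \<longleftrightarrow> R_projective R N"
    using assms(1) mod_iso_generated[OF iso assms(4)] by simp
  note inv = mod_iso_sym[OF iso]
  show ?thesis
  proof
    assume "projective R M"
    then show "R_projective R M"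
      using eq mod_iso_projective[OF iso] mod_iso_R_projective[OF inv] by simp
  next
    assume "R_projective R M"
    then show "projective R M"
      using eq mod_iso_R_projective[OF iso] mod_iso_projective[OF inv] by simp
  qed
qed

lemma a_kernel_eq: "a_kernel P M f = {x \<in> carrier P. f x = \<zero>\<^bsub>M\<^esub>}"
  by (simp add: a_kernel_def kernel_def)

lemma a_kernel_submodule:
  assumes "right_module R P" "right_module R M" "f \<in> mod_hom R P M"
  shows "submodule (a_kernel P M f) R P"
proof -
  interpret P: right_module R P by fact
  interpret M: right_module R M by fact
  show ?thesis
    by (rule P.sub_rmoduleI)
      (auto simp: a_kernel_eq mod_homD[OF assms(3)] mod_hom_zero[OF assms] mod_hom_uminus[OF assms])
qed

lemma in_set_addI: "k \<in> H \<Longrightarrow> l \<in> L \<Longrightarrow> k \<oplus>\<^bsub>P\<^esub> l \<in> H <+>\<^bsub>P\<^esub> L"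
  by (auto simp: set_add_def set_mult_def)

lemma mod_iso_projective_cover:
  assumes iso: "mod_iso R P Q \<phi> \<psi>" and M: "right_module R M" and c: "projective_cover R P f M"
  shows "projective_cover R Q (\<lambda>x. f (\<psi> x)) M"
proof -
  have h: "\<phi> \<in> mod_hom R P Q" "\<psi> \<in> mod_hom R Q P" "right_module R P" "right_module R Q"
    "\<And>x. x \<in> carrier P \<Longrightarrow> \<psi> (\<phi> x) = x" "\<And>y. y \<in> carrier Q \<Longrightarrow> \<phi> (\<psi> y) = y"
    using iso by (auto simp: mod_iso_def)
  interpret P: right_module R P by (rule h(3))
  interpret Q: right_module R Q by (rule h(4))
  have f: "projective R P" "f \<in> mod_hom R P M" "f ` carrier P = carrier M"
    "superfluous R P (a_kernel P M f)"
    using c by (auto simp: projective_cover_def)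
  let ?f = "\<lambda>x. f (\<psi> x)"
  note hf = mod_hom_comp[OF h(2) f(2)]
  have psi_surj: "\<psi> ` carrier Q = carrier P"
    using mod_homD(1)[OF h(2)] mod_homD(1)[OF h(1)] h(5) by (auto simp: image_iff) metis
  have "L = carrier Q" if L: "submodule L R Q" and sum: "a_kernel Q M ?f <+>\<^bsub>Q\<^esub> L = carrier Q" for L
  proof -
    note LQ = Q.sub_rmoduleD(1)[OF L]
    have sub: "submodule (\<psi> ` L) R P" by (rule submodule_image[OF h(4,3,2) L])
    have "a_kernel P M f <+>\<^bsub>P\<^esub> \<psi> ` L = carrier P"
    proof
      show "a_kernel P M f <+>\<^bsub>P\<^esub> \<psi> ` L \<subseteq> carrier P"
        using P.sub_rmoduleD(1)[OF sub] by (auto simp: set_add_def set_mult_def a_kernel_eq)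
      show "carrier P \<subseteq> a_kernel P M f <+>\<^bsub>P\<^esub> \<psi> ` L"
      proof
        fix x assume x: "x \<in> carrier P"
        then have "\<phi> x \<in> a_kernel Q M ?f <+>\<^bsub>Q\<^esub> L" using sum mod_homD(1)[OF h(1)] by simp
        then obtain k l where kl: "k \<in> carrier Q" "?f k = \<zero>\<^bsub>M\<^esub>" "l \<in> L" "\<phi> x = k \<oplus>\<^bsub>Q\<^esub> l"
          by (auto simp: set_add_def set_mult_def a_kernel_eq)
        then have "x = \<psi> k \<oplus>\<^bsub>P\<^esub> \<psi> l" using LQ x h(5) mod_homD(2)[OF h(2)] by (metis subsetD)
        moreover have "\<psi> k \<in> a_kernel P M f" using kl mod_homD(1)[OF h(2)] by (simp add: a_kernel_eq)
        ultimately show "x \<in> a_kernel P M f <+>\<^bsub>P\<^esub> \<psi> ` L"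
          using kl(3) by (auto simp: set_add_def set_mult_def)
      qed
    qed
    then have "\<psi> ` L = carrier P" using f(4) sub by (auto simp: superfluous_def)
    have "y \<in> L" if y: "y \<in> carrier Q" for y
    proof -
      obtain l where l: "l \<in> L" "\<psi> y = \<psi> l"
        using mod_homD(1)[OF h(2) y] \<open>\<psi> ` L = carrier P\<close> by blast
      then have "y = l" using h(6)[OF y] h(6)[of l] LQ by auto
      then show ?thesis using l(1) by simp
    qed
    then show ?thesis using LQ by auto
  qed
  moreover have "?f ` carrier Q = carrier M"
    using psi_surj f(3) by (metis image_image)
  ultimately show ?thesis
    using mod_iso_projective[OF iso f(1)] hf a_kernel_submodule[OF h(4) M hf]
    by (auto simp: projective_cover_def superfluous_def)
qed

lemma projective_cover_universe:
  fixes M :: "('a, 'b) module" and P :: "('a, 'p) module"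
  assumes M: "right_module R M" and c: "projective_cover R P f M"
  shows "\<exists>(Q :: ('a, 'b \<Rightarrow> 'a) module) f'. projective_cover R Q f' M"
proof -
  have f: "right_module R P" "f \<in> mod_hom R P M" "f ` carrier P = carrier M"
    "superfluous R P (a_kernel P M f)"
    using c by (auto simp: projective_cover_def projective_def)
  interpret M: right_module R M by fact
  interpret P: right_module R P by (rule f(1))
  let ?F = "free_right_module R (carrier M)"
  have F: "right_module R ?F" by (rule free_right_module) (rule M.R.ring_axioms)
  define n where "n = inv_into (carrier P) f"
  have n: "n x \<in> carrier P \<and> f (n x) = x" if "x \<in> carrier M" for x
    using that inv_into_into[of x f "carrier P"] f_inv_into_f[of x f "carrier P"]
    by (simp add: n_def f(3))
  have nA: "n \<in> carrier M \<rightarrow> carrier P" using n by auto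
  let ?h = "lin_comb R P n"
  note h = lin_comb_hom[OF f(1) nA]
  let ?L = "?h ` carrier ?F"
  have sub: "submodule ?L R P"
    by (rule submodule_image[OF F f(1) h]) (rule right_module.carrier_submodule[OF F])
  note LP = P.sub_rmoduleD[OF sub]
  have "a_kernel P M f <+>\<^bsub>P\<^esub> ?L = carrier P"
  proof
    show "a_kernel P M f <+>\<^bsub>P\<^esub> ?L \<subseteq> carrier P"
      using LP(1) by (auto simp: set_add_def set_mult_def a_kernel_eq)
    show "carrier P \<subseteq> a_kernel P M f <+>\<^bsub>P\<^esub> ?L"
    proof
      fix x assume x: "x \<in> carrier P"
      then have fx: "f x \<in> carrier M" using mod_homD(1)[OF f(2)] by simp
      let ?l = "n (f x)"
      have l: "?l \<in> ?L" "?l \<in> carrier P" "f ?l = f x"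
        using n[OF fx] lin_comb_unit[OF f(1) nA fx] by force+
      let ?k = "x \<ominus>\<^bsub>P\<^esub> ?l"
      have "f ?k = \<zero>\<^bsub>M\<^esub>"
        using x l fx mod_homD(2)[OF f(2)] mod_hom_uminus[OF f(1) M f(2)]
        by (simp add: a_minus_def M.M.r_neg)
      then have "?k \<in> a_kernel P M f" using x l by (simp add: a_kernel_eq)
      moreover have "x = ?k \<oplus>\<^bsub>P\<^esub> ?l" using x l by (simp add: a_minus_def P.M.a_assoc P.M.l_neg)
      ultimately show "x \<in> a_kernel P M f <+>\<^bsub>P\<^esub> ?L"
        using in_set_addI[OF _ l(1), of ?k "a_kernel P M f" P] by simp
    qed
  qed
  then have "?L = carrier P" using f(4) sub by (auto simp: superfluous_def)
  then have "inj_on (inv_into (carrier ?F) ?h) (carrier P)" by (metis inj_on_inv_into order_refl)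
  from inj_imp_mod_iso[OF f(1) this] obtain Q :: "('a, 'b \<Rightarrow> 'a) module" and \<psi>
    where "mod_iso R P Q (inv_into (carrier ?F) ?h) \<psi>" by blast
  from mod_iso_projective_cover[OF this M c] show ?thesis by blast
qed

end

theory Submission
  imports Defs
begin

text \<open>
  Since a basis \<open>B\<close> of \<open>V\<close> satisfies \<open>|B \<times> X| \<le> |B|\<close> for \<open>|X| \<le> \<kappa>\<close>, the free right module on
  \<open>X\<close> embeds into \<open>R = End V\<close> as a right ideal. Hence a module \<open>M\<close> generated by \<open>X\<close> is \<open>j F / I\<close>
  with \<open>I \<subseteq> j F\<close> right ideals and \<open>j F\<close> free, and embeds into \<open>R / I\<close>. If \<open>M\<close> is \<open>R\<close>-projective, this
  embedding lifts to \<open>g : M \<rightarrow> R\<close>; the image of \<open>g\<close> lies in \<open>j F + I = j F\<close>, so \<open>g\<close> splits \<open>F \<rightarrow> M\<close>.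

  For the failure of perfectness let \<open>I\<close> consist of the endomorphisms that kill almost all of \<open>B\<close>.
  A projective cover \<open>f : P \<rightarrow> R / I\<close> would be a quotient \<open>h : R \<rightarrow> P\<close>, split by some \<open>g\<close>. Put
  \<open>e = g (h 1) \<noteq> 0\<close>. For each \<open>q \<in> I\<close> the submodule \<open>h ((1 - q) R)\<close> still maps onto \<open>R / I\<close>, so it is
  all of \<open>P\<close> and \<open>e = e (1 - q) r\<close> for some \<open>r\<close>. This is impossible when \<open>q\<close> fixes a nonzero vector
  in the image of \<open>e\<close>.
\<close>

section \<open>Quotients, free covers and projectivity\<close>

lemma (in ring) regular_right_module: "right_module R (regular_right_module R)"
proof (intro right_module.intro abelian_groupI right_module_axioms.intro)
  show "ring R" by (rule ring_axioms)
  show "\<exists>y\<in>carrier (regular_right_module R).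
      y \<oplus>\<^bsub>regular_right_module R\<^esub> x = \<zero>\<^bsub>regular_right_module R\<^esub>"
    if "x \<in> carrier (regular_right_module R)" for x
    using that by (intro bexI[where x = "\<ominus> x"]) (auto simp: regular_right_module_def l_neg)
qed (auto simp: regular_right_module_def a_assoc a_comm a_lcomm m_assoc l_distr r_distr)

lemma regular_simps [simp]:
  "carrier (regular_right_module R) = carrier R"
  "zero (regular_right_module R) = zero R"
  "add (regular_right_module R) = add R"
  "smult (regular_right_module R) = (\<lambda>a x. x \<otimes>\<^bsub>R\<^esub> a)"
  by (simp_all add: regular_right_module_def)

text \<open>Cosets and differences only involve the additive structure, which a ring shares with its
  regular module. This turns general facts about quotient modules into the ring notation used in
  \<open>R_projective\<close>.\<close>

lemma regular_a_r_coset: "(+>\<^bsub>regular_right_module R\<^esub>) = (+>\<^bsub>R\<^esub>)"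
  by (intro ext) (simp add: a_r_coset_def r_coset_def)

lemma regular_a_minus: "a_minus (regular_right_module R) = a_minus R"
  by (intro ext) (simp add: a_minus_def a_inv_def m_inv_def)

lemma (in right_module) submodule_abelian_subgroup:
  assumes "submodule N R M" shows "abelian_subgroup N M"
proof (rule abelian_subgroupI3)
  show "additive_subgroup N M"
    using assms by (intro additive_subgroupI) (simp add: submodule_def)
  show "abelian_group M" by (rule M.abelian_group_axioms)
qed

lemma (in right_module) coset_eq_iff:
  assumes N: "submodule N R M" and xy: "x \<in> carrier M" "y \<in> carrier M"
  shows "N +>\<^bsub>M\<^esub> x = N +>\<^bsub>M\<^esub> y \<longleftrightarrow> x \<ominus>\<^bsub>M\<^esub> y \<in> N"
proof -
  interpret N: abelian_subgroup N M by (rule submodule_abelian_subgroup[OF N])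
  show ?thesis
    using N.a_rcos_module[OF xy(2,1)] N.a_repr_independence'[OF _ xy(2), of x]
      N.a_rcos_self[OF xy(1)] by (auto simp: a_minus_def)
qed

lemma (in right_module) quotient_right_module:
  assumes N: "submodule N R M"
  shows "right_module R (quotient_right_module M N)"
    and "(\<lambda>x. N +>\<^bsub>M\<^esub> x) \<in> mod_hom R M (quotient_right_module M N)"
    and "(\<lambda>x. N +>\<^bsub>M\<^esub> x) ` carrier M = carrier (quotient_right_module M N)"
    and "zero (quotient_right_module M N) = N"
proof -
  interpret N: abelian_subgroup N M by (rule submodule_abelian_subgroup[OF N])
  note sub = sub_rmoduleD[OF N]
  let ?Q = "quotient_right_module M N"
  show zero: "zero ?Q = N" by (simp add: quotient_right_module_def)
  show surj: "(\<lambda>x. N +>\<^bsub>M\<^esub> x) ` carrier M = carrier ?Q"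
    by (auto simp: quotient_right_module_def A_RCOSETS_def' a_r_coset_def')
  have add: "(N +>\<^bsub>M\<^esub> x) \<oplus>\<^bsub>?Q\<^esub> (N +>\<^bsub>M\<^esub> y) = N +>\<^bsub>M\<^esub> (x \<oplus>\<^bsub>M\<^esub> y)"
    if "x \<in> carrier M" "y \<in> carrier M" for x y
    using N.a_rcos_sum[OF that] by (simp add: quotient_right_module_def)
  have smult: "a \<odot>\<^bsub>?Q\<^esub> (N +>\<^bsub>M\<^esub> x) = N +>\<^bsub>M\<^esub> (a \<odot>\<^bsub>M\<^esub> x)"
    if x: "x \<in> carrier M" and a: "a \<in> carrier R" for x a
  proof -
    \<comment> \<open>The action on a quotient is defined as a union over all representatives of a
      coset. Since N is a submodule, they all contribute the same coset, so the union collapses to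
      it.\<close>
    have eq: "N +>\<^bsub>M\<^esub> (y \<triangleleft>\<^bsub>M\<^esub> a) = N +>\<^bsub>M\<^esub> (x \<triangleleft>\<^bsub>M\<^esub> a)" if "y \<in> N +>\<^bsub>M\<^esub> x" for y
    proof -
      from that obtain n where n: "n \<in> N" "y = n \<oplus>\<^bsub>M\<^esub> x" by (auto simp: a_r_coset_def')
      then have "n \<triangleleft>\<^bsub>M\<^esub> a \<oplus>\<^bsub>M\<^esub> x \<triangleleft>\<^bsub>M\<^esub> a \<in> N +>\<^bsub>M\<^esub> (x \<triangleleft>\<^bsub>M\<^esub> a)"
        using sub(1,5) x a by (intro M.a_rcosI) auto
      then show ?thesis
        using n sub(1) x a N.a_repr_independence' rsmult_add_vector[of n x a] by auto
    qed
    have "(\<Union>y\<in>N +>\<^bsub>M\<^esub> x. N +>\<^bsub>M\<^esub> (y \<triangleleft>\<^bsub>M\<^esub> a)) = (\<Union>y\<in>N +>\<^bsub>M\<^esub> x. N +>\<^bsub>M\<^esub> (x \<triangleleft>\<^bsub>M\<^esub> a))"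
      by (rule SUP_cong[OF refl eq])
    also have "\<dots> = N +>\<^bsub>M\<^esub> (x \<triangleleft>\<^bsub>M\<^esub> a)" using N.a_rcos_self[OF x] by blast
    finally show ?thesis by (simp add: quotient_right_module_def)
  qed
  have zero0: "\<zero>\<^bsub>?Q\<^esub> = N +>\<^bsub>M\<^esub> \<zero>\<^bsub>M\<^esub>" using sub(1) zero by simp
  have Q: "\<exists>x\<in>carrier M. X = N +>\<^bsub>M\<^esub> x" if "X \<in> carrier ?Q" for X
    using that surj by blast
  have cl: "N +>\<^bsub>M\<^esub> x \<in> carrier ?Q" if "x \<in> carrier M" for x
    using that surj by blast
  show "(\<lambda>x. N +>\<^bsub>M\<^esub> x) \<in> mod_hom R M ?Q"
    using cl add smult by (auto simp: mod_hom_def)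
  have "abelian_group ?Q"
  proof (rule abelian_groupI)
    show "\<exists>Y\<in>carrier ?Q. Y \<oplus>\<^bsub>?Q\<^esub> X = \<zero>\<^bsub>?Q\<^esub>" if "X \<in> carrier ?Q" for X
    proof -
      from Q[OF that] obtain x where "x \<in> carrier M" "X = N +>\<^bsub>M\<^esub> x" by blast
      then show ?thesis
        using cl add[of "\<ominus>\<^bsub>M\<^esub> x" x] zero0
        by (intro bexI[of _ "N +>\<^bsub>M\<^esub> (\<ominus>\<^bsub>M\<^esub> x)"]) (auto simp: M.l_neg)
    qed
    show "\<zero>\<^bsub>?Q\<^esub> \<in> carrier ?Q" using cl[of "\<zero>\<^bsub>M\<^esub>"] zero0 by simp
    show "\<zero>\<^bsub>?Q\<^esub> \<oplus>\<^bsub>?Q\<^esub> X = X" if "X \<in> carrier ?Q" for X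
    proof -
      from Q[OF that] obtain x where "x \<in> carrier M" "X = N +>\<^bsub>M\<^esub> x" by blast
      then show ?thesis using add[of "\<zero>\<^bsub>M\<^esub>" x] zero0 by simp
    qed
    show "(X \<oplus>\<^bsub>?Q\<^esub> Y) \<oplus>\<^bsub>?Q\<^esub> Z = X \<oplus>\<^bsub>?Q\<^esub> (Y \<oplus>\<^bsub>?Q\<^esub> Z)"
      if "X \<in> carrier ?Q" "Y \<in> carrier ?Q" "Z \<in> carrier ?Q" for X Y Z
      using that[THEN Q] by (elim bexE) (simp add: add M.a_assoc)
    show "X \<oplus>\<^bsub>?Q\<^esub> Y = Y \<oplus>\<^bsub>?Q\<^esub> X" if "X \<in> carrier ?Q" "Y \<in> carrier ?Q" for X Y
      using that[THEN Q] by (elim bexE) (simp add: add M.a_comm)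
    show "X \<oplus>\<^bsub>?Q\<^esub> Y \<in> carrier ?Q" if "X \<in> carrier ?Q" "Y \<in> carrier ?Q" for X Y
      using that[THEN Q] by (elim bexE) (simp add: add cl)
  qed
  then show "right_module R ?Q"
    by (intro right_module.intro R.ring_axioms right_module_axioms.intro)
      (auto dest!: Q simp: add smult cl rsmult_add_scalar rsmult_add_vector rsmult_assoc)
qed

lemma (in ring) quotient_by_right_ideal:
  assumes "right_ideal I R"
  shows "right_module R (quotient_right_module (regular_right_module R) I)"
    and "(\<lambda>x. I +> x) \<in> mod_hom R (regular_right_module R)
           (quotient_right_module (regular_right_module R) I)"
    and "(\<lambda>x. I +> x) ` carrier R = carrier (quotient_right_module (regular_right_module R) I)"
    and "zero (quotient_right_module (regular_right_module R) I) = I"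
    and "\<lbrakk>x \<in> carrier R; y \<in> carrier R\<rbrakk> \<Longrightarrow> I +> x = I +> y \<longleftrightarrow> x \<ominus> y \<in> I"
  using right_module.quotient_right_module[OF regular_right_module, of I]
    right_module.coset_eq_iff[OF regular_right_module, of I x y] assms
  by (simp_all add: right_ideal_def regular_a_r_coset regular_a_minus)

text \<open>The projection from R onto R / I is an epimorphism. Its source and target have other
  element types than those in the definition of \<open>projective\<close>, hence the appeal to
  \<open>projective_lift\<close>.\<close>

lemma projective_imp_R_projective:
  assumes "projective R M"
  shows "R_projective R M"
proof -
  have M: "right_module R M" using assms by (simp add: projective_def)
  then interpret right_module R M .
  show ?thesis unfolding R_projective_def
  proof (intro conjI allI impI ballI M)
    fix I f
    assume I: "right_ideal I R"
      and f: "f \<in> mod_hom R M (quotient_right_module (regular_right_module R) I)"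
    note Q = R.quotient_by_right_ideal[OF I]
    show "\<exists>g\<in>mod_hom R M (regular_right_module R). \<forall>x\<in>carrier M. f x = I +>\<^bsub>R\<^esub> g x"
      using projective_lift[OF assms R.regular_right_module Q(1,2) _ f] Q(3) by auto metis
  qed
qed

text \<open>A direct summand of the free module on X inherits its lifting property: choose preimages
  \<open>n\<close> of the values of \<open>f\<close> on X only, extend them linearly to the free
  module and compose with the splitting \<open>s\<close>.\<close>

lemma retract_of_free_projective:
  assumes M: "right_module R M" and X: "X \<subseteq> carrier M"
    and s: "s \<in> mod_hom R M (free_right_module R X)"
    and split: "\<And>x. x \<in> carrier M \<Longrightarrow> lin_comb R M (\<lambda>x. x) (s x) = x"
  shows "projective R M"
  unfolding projective_def
proof (intro conjI M allI impI ballI)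
  fix N :: "('a, 'c \<Rightarrow> 'a) module" and P :: "('a, 'c) module" and p f
  assume "right_module R N \<and> right_module R P" and p: "p \<in> mod_hom R N P"
    and surj: "p ` carrier N = carrier P" and f: "f \<in> mod_hom R M P"
  then have N: "right_module R N" and P: "right_module R P" by auto
  interpret P: right_module R P by fact
  have "\<forall>x\<in>X. \<exists>y\<in>carrier N. p y = f x"
    using mod_homD(1)[OF f] surj X by (metis imageE subsetD)
  then obtain n where n: "\<And>x. x \<in> X \<Longrightarrow> n x \<in> carrier N \<and> p (n x) = f x" by metis
  then have nX: "n \<in> X \<rightarrow> carrier N" by auto
  have "p (lin_comb R N n (s x)) = f x" if x: "x \<in> carrier M" for x
  proof -
    have sx: "s x \<in> carrier (free_right_module R X)" using mod_homD(1)[OF s x] .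
    then have supp: "{i. s x i \<noteq> \<zero>\<^bsub>R\<^esub>} \<subseteq> X" "\<And>i. s x i \<in> carrier R"
      by (auto simp: free_right_module_def)
    have "p (lin_comb R N n (s x)) = lin_comb R P (\<lambda>i. p (n i)) (s x)"
      by (rule mod_hom_lin_comb[OF N P p nX sx])
    also have "\<dots> = lin_comb R P f (s x)"
      unfolding lin_comb_def using supp n mod_homD(1)[OF f] X
      by (intro P.M.finsum_cong') (auto simp: subset_iff)
    also have "\<dots> = f x"
      using mod_hom_lin_comb[OF M P f _ sx, of "\<lambda>x. x"] X split[OF x]
      by (simp add: Pi_iff subset_iff)
    finally show ?thesis .
  qed
  then show "\<exists>g\<in>mod_hom R M N. \<forall>x\<in>carrier M. p (g x) = f x"
    by (intro bexI[OF _ mod_hom_comp[OF s lin_comb_hom[OF N nX]]]) auto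
qed

lemma lin_comb_generates:
  assumes M: "right_module R M" and X: "generates R M X"
  shows "lin_comb R M (\<lambda>x. x) ` carrier (free_right_module R X) = carrier M"
proof -
  interpret right_module R M by fact
  have XM: "X \<subseteq> carrier M" using X by (simp add: generates_def)
  then have id: "(\<lambda>x. x) \<in> X \<rightarrow> carrier M" by auto
  have F: "right_module R (free_right_module R X)"
    by (rule free_right_module) (rule R.ring_axioms)
  have "submodule (lin_comb R M (\<lambda>x. x) ` carrier (free_right_module R X)) R M"
    by (rule submodule_image[OF F M lin_comb_hom[OF M id]])
      (rule right_module.carrier_submodule[OF F])
  moreover have "X \<subseteq> lin_comb R M (\<lambda>x. x) ` carrier (free_right_module R X)"
    using lin_comb_unit[OF M id] by force
  ultimately show ?thesis using X by (simp add: generates_def)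
qed

lemma mod_hom_inv_into:
  assumes "right_module R M" "f \<in> mod_hom R M N" "inj_on f (carrier M)" "f ` carrier M = carrier N"
  shows "inv_into (carrier M) f \<in> mod_hom R N M"
proof -
  interpret right_module R M by fact
  have img: "\<exists>u\<in>carrier M. y = f u" if "y \<in> carrier N" for y using that assms(4) by blast
  show ?thesis
    using assms(3) mod_homD(2,3)[OF assms(2), symmetric]
    by (auto dest!: img simp: mod_hom_def)
qed

section \<open>R-projective modules whose free cover embeds into the ring\<close>

lemma (in abelian_group) minus_eq_zero_iff:
  assumes "x \<in> carrier G" "y \<in> carrier G"
  shows "x \<ominus> y = \<zero> \<longleftrightarrow> x = y"
proof
  assume "x \<ominus> y = \<zero>"
  then have "(x \<ominus> y) \<oplus> y = y" using assms by simp
  then show "x = y" using assms by (simp add: a_minus_def a_assoc l_neg)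
qed (use assms in \<open>simp add: a_minus_def r_neg\<close>)

lemma R_projective_imp_projective:
  assumes M: "R_projective R M" and X: "generates R M X"
    and j: "j \<in> mod_hom R (free_right_module R X) (regular_right_module R)"
    and inj: "inj_on j (carrier (free_right_module R X))"
  shows "projective R M"
proof -
  have rM: "right_module R M" using M by (simp add: R_projective_def)
  then interpret right_module R M .
  let ?F = "free_right_module R X"
  let ?e = "lin_comb R M (\<lambda>x. x)"
  let ?S = "regular_right_module R"
  note S = R.regular_right_module
  have XM: "X \<subseteq> carrier M" using X by (simp add: generates_def)
  have F: "right_module R ?F" by (rule free_right_module) (rule R.ring_axioms)
  then interpret F: right_module R ?F .
  have e: "?e \<in> mod_hom R ?F M" by (rule lin_comb_hom[OF rM]) (use XM in auto)
  note surj = lin_comb_generates[OF rM X]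
  \<comment> \<open>The relations among the generators X, moved into R by \<open>j\<close>; thus I
    is a right ideal contained in the image of \<open>j\<close>.\<close>
  define I where "I = j ` a_kernel ?F M ?e"
  have I: "right_ideal I R"
    unfolding right_ideal_def I_def
    by (rule submodule_image[OF F S j a_kernel_submodule[OF F rM e]])
  note Q = R.quotient_by_right_ideal[OF I]
  let ?Q = "quotient_right_module ?S I"
  have jF: "j c \<in> carrier R" if "c \<in> carrier ?F" for c
    using mod_homD(1)[OF j that] by simp
  have j_diff: "j c \<ominus>\<^bsub>R\<^esub> j d = j (c \<ominus>\<^bsub>?F\<^esub> d)" if "c \<in> carrier ?F" "d \<in> carrier ?F" for c d
    using that mod_homD(2)[OF j, of c "\<ominus>\<^bsub>?F\<^esub> d"] mod_hom_uminus[OF F S j, of d]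
      fun_cong[OF fun_cong[OF regular_a_minus[of R]], of "j c" "j d"]
    by (simp add: a_minus_def)
  have e_diff: "?e (c \<ominus>\<^bsub>?F\<^esub> d) = ?e c \<ominus>\<^bsub>M\<^esub> ?e d" if "c \<in> carrier ?F" "d \<in> carrier ?F" for c d
    using that mod_homD(2)[OF e, of c "\<ominus>\<^bsub>?F\<^esub> d"] mod_hom_uminus[OF F rM e, of d]
    by (simp add: a_minus_def)
  \<comment> \<open>Right to left, this makes the map from M to R / I well defined; left to right,
    it makes that map injective, which at the end gives \<open>?e (s x) = x\<close>.\<close>
  have key: "I +>\<^bsub>R\<^esub> j c = I +>\<^bsub>R\<^esub> j d \<longleftrightarrow> ?e c = ?e d"
    if c: "c \<in> carrier ?F" and d: "d \<in> carrier ?F" for c d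
  proof -
    have "I +>\<^bsub>R\<^esub> j c = I +>\<^bsub>R\<^esub> j d \<longleftrightarrow> j (c \<ominus>\<^bsub>?F\<^esub> d) \<in> I"
      using Q(5)[OF jF[OF c] jF[OF d]] j_diff[OF c d] by simp
    also have "\<dots> \<longleftrightarrow> c \<ominus>\<^bsub>?F\<^esub> d \<in> a_kernel ?F M ?e"
      unfolding I_def using c d by (intro inj_on_image_mem_iff[OF inj]) (auto simp: a_kernel_eq)
    also have "\<dots> \<longleftrightarrow> ?e c = ?e d"
      using c d e_diff[OF c d] M.minus_eq_zero_iff mod_homD(1)[OF e] by (simp add: a_kernel_eq)
    finally show ?thesis .
  qed
  define n where "n = inv_into (carrier ?F) ?e"
  have n: "n x \<in> carrier ?F" "?e (n x) = x" if "x \<in> carrier M" for x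
    using that inv_into_into[of x ?e "carrier ?F"] f_inv_into_f[of x ?e "carrier ?F"]
    by (simp_all add: n_def surj)
  \<comment> \<open>The embedding of M into R / I. The choice of preimages \<open>n\<close> need not
    be linear; \<open>f_e\<close> shows that \<open>f\<close> does not depend on it, and linearity
    follows.\<close>
  define f where "f x = I +>\<^bsub>R\<^esub> j (n x)" for x
  have f_e: "f (?e c) = I +>\<^bsub>R\<^esub> j c" if "c \<in> carrier ?F" for c
    using that key[of "n (?e c)" c] n mod_homD(1)[OF e that] by (simp add: f_def)
  have jQ: "(\<lambda>c. I +>\<^bsub>R\<^esub> j c) \<in> mod_hom R ?F ?Q" by (rule mod_hom_comp[OF j Q(2)])
  have M_e: "\<exists>c\<in>carrier ?F. x = ?e c" if "x \<in> carrier M" for x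
    using n[OF that] by metis
  have "f \<in> mod_hom R M ?Q"
    unfolding mod_hom_def
    using mod_homD[OF jQ]
    by (auto dest!: M_e simp: f_e mod_homD(2,3)[OF e, symmetric])
  with M I obtain g where g: "g \<in> mod_hom R M ?S" "\<And>x. x \<in> carrier M \<Longrightarrow> f x = I +>\<^bsub>R\<^esub> g x"
    unfolding R_projective_def by metis
  let ?J = "j ` carrier ?F"
  have J: "submodule ?J R ?S" by (rule submodule_image[OF F S j F.carrier_submodule])
  \<comment> \<open>The element \<open>g x\<close> differs from \<open>j (n x)\<close> by an element
    of I, and I lies inside the image of \<open>j\<close>. So \<open>g\<close> takes its values in a
    copy of the free module.\<close>
  have lift: "\<exists>c\<in>carrier ?F. g x = j c" if x: "x \<in> carrier M" for x
  proof -
    have gx: "g x \<in> carrier R" using mod_homD(1)[OF g(1) x] by simp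
    have "g x \<ominus>\<^bsub>R\<^esub> j (n x) \<in> I"
      using g(2)[OF x] Q(5)[OF gx jF[OF n(1)[OF x]]] by (simp add: f_def)
    then have "g x \<ominus>\<^bsub>R\<^esub> j (n x) \<in> ?J" by (auto simp: I_def a_kernel_eq)
    moreover have "j (n x) \<in> ?J" using n(1)[OF x] by blast
    ultimately have "(g x \<ominus>\<^bsub>R\<^esub> j (n x)) \<oplus>\<^bsub>R\<^esub> j (n x) \<in> ?J"
      using right_module.sub_rmoduleD(4)[OF S J] by simp
    moreover have "(g x \<ominus>\<^bsub>R\<^esub> j (n x)) \<oplus>\<^bsub>R\<^esub> j (n x) = g x"
      using gx jF[OF n(1)[OF x]] by (simp add: a_minus_def R.a_assoc R.l_neg)
    ultimately show ?thesis by auto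
  qed
  \<comment> \<open>Pulling \<open>g\<close> back along the injective homomorphism \<open>j\<close>
    gives a linear section of the free cover.\<close>
  define s where "s x = inv_into (carrier ?F) j (g x)" for x
  have s: "s x \<in> carrier ?F" "j (s x) = g x" if "x \<in> carrier M" for x
    using lift[OF that] inv_into_into[of "g x" j "carrier ?F"] f_inv_into_f[of "g x" j "carrier ?F"]
    by (auto simp: s_def)
  have sI: "s x = c" if "x \<in> carrier M" "c \<in> carrier ?F" "j c = g x" for x c
    using that inv_into_f_f[OF inj, of c] by (simp add: s_def)
  have "s \<in> mod_hom R M ?F"
    using s sI mod_homD(2,3)[OF j] mod_homD(2,3)[OF g(1)]
    by (auto simp: mod_hom_def intro!: sI)
  moreover have "?e (s x) = x" if x: "x \<in> carrier M" for x
    using key[OF s(1)[OF x] n(1)[OF x]] g(2)[OF x] s(2)[OF x] n(2)[OF x] by (simp add: f_def)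
  ultimately show ?thesis by (rule retract_of_free_projective[OF rM XM])
qed

text \<open>R is free on one generator; the index set is the singleton of the unit, because linear
  combinations here are indexed by module elements.\<close>

lemma (in ring) regular_projective: "projective R (regular_right_module R)"
proof (rule retract_of_free_projective[of _ _ "{\<one>}"])
  let ?s = "\<lambda>x i. if i = \<one> then x else \<zero>"
  show "?s \<in> mod_hom R (regular_right_module R) (free_right_module R {\<one>})"
    by (auto simp: mod_hom_def free_right_module_def fun_eq_iff split: if_splits)
  show "lin_comb R (regular_right_module R) (\<lambda>x. x) (?s x) = x"
    if x: "x \<in> carrier (regular_right_module R)" for x
  proof -
    interpret S: right_module R "regular_right_module R" by (rule regular_right_module)
    have "lin_comb R (regular_right_module R) (\<lambda>x. x) (?s x)
        = finsum (regular_right_module R) (\<lambda>i. i \<triangleleft>\<^bsub>regular_right_module R\<^esub> ?s x i) {\<one>}"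
      by (rule lin_comb_superset[where A = "{\<one>}"])
        (use x in \<open>auto simp: free_right_module_def regular_right_module\<close>)
    also have "\<dots> = x" using x by (subst S.M.finsum_insert) auto
    finally show ?thesis .
  qed
qed (auto simp: regular_right_module)

section \<open>Modules without projective cover\<close>

lemma projective_cover_image_eq:
  assumes c: "projective_cover R P f M" and M: "right_module R M"
    and L: "submodule L R P" and img: "carrier M \<subseteq> f ` L"
  shows "L = carrier P"
proof -
  have f: "right_module R P" "f \<in> mod_hom R P M" "superfluous R P (a_kernel P M f)"
    using c by (auto simp: projective_cover_def projective_def)
  interpret M: right_module R M by fact
  interpret P: right_module R P by (rule f(1))
  note LP = P.sub_rmoduleD[OF L]
  have "carrier P \<subseteq> a_kernel P M f <+>\<^bsub>P\<^esub> L"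
  proof
    fix x assume x: "x \<in> carrier P"
    then obtain l where l: "l \<in> L" "f x = f l" using img mod_homD(1)[OF f(2)] by blast
    then have lP: "l \<in> carrier P" using LP(1) by auto
    have "f (x \<ominus>\<^bsub>P\<^esub> l) = \<zero>\<^bsub>M\<^esub>"
      using x lP l(2) mod_homD[OF f(2)] mod_hom_uminus[OF f(1) M f(2)]
      by (simp add: a_minus_def M.M.r_neg)
    then have "x \<ominus>\<^bsub>P\<^esub> l \<in> a_kernel P M f" using x lP by (simp add: a_kernel_eq)
    moreover have "x = (x \<ominus>\<^bsub>P\<^esub> l) \<oplus>\<^bsub>P\<^esub> l" using x lP by (simp add: a_minus_def P.M.a_assoc P.M.l_neg)
    ultimately show "x \<in> a_kernel P M f <+>\<^bsub>P\<^esub> L"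
      using in_set_addI[OF _ l(1), of "x \<ominus>\<^bsub>P\<^esub> l" "a_kernel P M f" P] by simp
  qed
  moreover have "a_kernel P M f <+>\<^bsub>P\<^esub> L \<subseteq> carrier P"
    using LP(1) by (auto simp: set_add_def set_mult_def a_kernel_eq)
  ultimately show ?thesis using f(3) L by (auto simp: superfluous_def)
qed

text \<open>The cyclic module is given by an epimorphism \<open>p\<close> from R instead of as a
  quotient, so that the result also applies to a copy of R / I with another element type.\<close>

lemma no_projective_cover:
  assumes M: "right_module R M"
    and p: "p \<in> mod_hom R (regular_right_module R) M" "p ` carrier R = carrier M"
    and p1: "p \<one>\<^bsub>R\<^esub> \<noteq> \<zero>\<^bsub>M\<^esub>"
    and q: "\<And>e. \<lbrakk>e \<in> carrier R; e \<noteq> \<zero>\<^bsub>R\<^esub>\<rbrakk> \<Longrightarrow> \<exists>q \<in> carrier R. p q = \<zero>\<^bsub>M\<^esub> \<and>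
      (\<forall>r\<in>carrier R. e \<otimes>\<^bsub>R\<^esub> ((\<one>\<^bsub>R\<^esub> \<ominus>\<^bsub>R\<^esub> q) \<otimes>\<^bsub>R\<^esub> r) \<noteq> e)"
  shows "\<not> projective_cover R P f M"
proof
  assume c: "projective_cover R P f M"
  then have f: "projective R P" "right_module R P" "f \<in> mod_hom R P M" "f ` carrier P = carrier M"
    by (auto simp: projective_cover_def projective_def)
  interpret M: right_module R M by fact
  interpret P: right_module R P by (rule f(2))
  let ?S = "regular_right_module R"
  note S = M.R.regular_right_module
  interpret S: right_module R ?S by (rule S)
  obtain h where h: "h \<in> mod_hom R ?S P" "\<And>x. x \<in> carrier R \<Longrightarrow> f (h x) = p x"
    using projective_lift[OF M.R.regular_projective f(2) M f(3,4) p(1)] by auto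
  \<comment> \<open>The image of \<open>h\<close> is a submodule that \<open>f\<close> maps onto M.
    Lifting the identity of the projective module P along the now surjective \<open>h\<close> then
    yields the splitting \<open>g\<close>.\<close>
  have "h ` carrier ?S = carrier P"
    by (rule projective_cover_image_eq[OF c M submodule_image[OF S f(2) h(1) S.carrier_submodule]])
      (use h(2) p(2) in \<open>simp add: image_image cong: image_cong_simp\<close>)
  then obtain g where g: "g \<in> mod_hom R P ?S" "\<And>x. x \<in> carrier P \<Longrightarrow> h (g x) = x"
    using projective_lift[OF f(1) S f(2) h(1) _, of "\<lambda>x. x"] by (auto simp: mod_hom_def)
  have h1: "h \<one>\<^bsub>R\<^esub> \<in> carrier P" using mod_homD(1)[OF h(1)] by simp
  define e where "e = g (h \<one>\<^bsub>R\<^esub>)"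
  have e: "e \<in> carrier R" using mod_homD(1)[OF g(1) h1] by (simp add: e_def)
  \<comment> \<open>The composite is an endomorphism of the right module R, hence left
    multiplication by its value at the unit.\<close>
  have gh: "g (h x) = e \<otimes>\<^bsub>R\<^esub> x" if "x \<in> carrier R" for x
    using that mod_homD(3)[OF h(1), of "\<one>\<^bsub>R\<^esub>" x] mod_homD(3)[OF g(1) h1, of x] by (simp add: e_def)
  have "e \<noteq> \<zero>\<^bsub>R\<^esub>"
  proof
    assume "e = \<zero>\<^bsub>R\<^esub>"
    then have "h \<one>\<^bsub>R\<^esub> = \<zero>\<^bsub>P\<^esub>"
      using g(2)[OF h1] mod_hom_zero[OF S f(2) h(1)] by (simp add: e_def)
    then show False using h(2)[of "\<one>\<^bsub>R\<^esub>"] mod_hom_zero[OF f(2) M f(3)] p1 by simp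
  qed
  with q[OF e] obtain q where q: "q \<in> carrier R" "p q = \<zero>\<^bsub>M\<^esub>"
      "\<And>r. r \<in> carrier R \<Longrightarrow> e \<otimes>\<^bsub>R\<^esub> ((\<one>\<^bsub>R\<^esub> \<ominus>\<^bsub>R\<^esub> q) \<otimes>\<^bsub>R\<^esub> r) \<noteq> e"
    by metis
  let ?u = "\<one>\<^bsub>R\<^esub> \<ominus>\<^bsub>R\<^esub> q"
  have u: "?u \<in> carrier R" using q(1) by simp
  \<comment> \<open>Left multiplication by \<open>?u\<close> is right linear, and \<open>p\<close>
    does not notice it because \<open>p ?u = p 1\<close>. Hence the image of R under
    \<open>?l\<close> followed by \<open>h\<close> still maps onto M.\<close>
  let ?l = "\<lambda>r. ?u \<otimes>\<^bsub>R\<^esub> r"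
  have l: "?l \<in> mod_hom R ?S ?S"
    using u by (auto simp: mod_hom_def M.R.r_distr M.R.m_assoc)
  note hl = mod_hom_comp[OF l h(1)]
  have pu: "p ?u = p \<one>\<^bsub>R\<^esub>"
  proof -
    have "?u \<oplus>\<^bsub>R\<^esub> q = \<one>\<^bsub>R\<^esub>" using q(1) by (simp add: a_minus_def M.R.a_assoc M.R.l_neg)
    then have "p ?u \<oplus>\<^bsub>M\<^esub> p q = p \<one>\<^bsub>R\<^esub>" using mod_homD(2)[OF p(1), of ?u q] u q(1) by simp
    then show ?thesis using q(2) mod_homD(1)[OF p(1), of ?u] u by simp
  qed
  have fhl: "f (h (?l r)) = p r" if r: "r \<in> carrier R" for r
  proof -
    have "f (h (?l r)) = r \<odot>\<^bsub>M\<^esub> p ?u" using r u h(2) mod_homD(3)[OF p(1), of ?u r] by simp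
    also have "\<dots> = p r" using pu r mod_homD(3)[OF p(1), of "\<one>\<^bsub>R\<^esub>" r] by simp
    finally show ?thesis .
  qed
  have "(\<lambda>r. h (?l r)) ` carrier ?S = carrier P"
    by (rule projective_cover_image_eq[OF c M submodule_image[OF S f(2) hl S.carrier_submodule]])
      (use fhl p(2) in \<open>simp add: image_image cong: image_cong_simp\<close>)
  then have "h \<one>\<^bsub>R\<^esub> \<in> (\<lambda>r. h (?l r)) ` carrier R" using h1 by simp
  then obtain r where r: "r \<in> carrier R" "h \<one>\<^bsub>R\<^esub> = h (?l r)" by (elim imageE)
  then have "e = e \<otimes>\<^bsub>R\<^esub> (?u \<otimes>\<^bsub>R\<^esub> r)" using gh[of "?l r"] u by (simp add: e_def)
  with q(3)[OF r(1)] show False by simp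
qed

text \<open>The module without a projective cover is R / I. For each nonzero \<open>e\<close> the
  last hypothesis supplies \<open>q\<close> in I such that \<open>e\<close> is not in
  \<open>e (1 - q) R\<close>.\<close>

lemma not_right_perfectI:
  fixes R :: "('a, 'x) ring_scheme"
  assumes R: "ring R" and I: "right_ideal I R" and one: "\<one>\<^bsub>R\<^esub> \<notin> I"
    and q: "\<And>e. \<lbrakk>e \<in> carrier R; e \<noteq> \<zero>\<^bsub>R\<^esub>\<rbrakk> \<Longrightarrow>
      \<exists>q \<in> I. \<forall>r\<in>carrier R. e \<otimes>\<^bsub>R\<^esub> ((\<one>\<^bsub>R\<^esub> \<ominus>\<^bsub>R\<^esub> q) \<otimes>\<^bsub>R\<^esub> r) \<noteq> e"
  shows "\<not> right_perfect R"
proof -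
  interpret R: ring R by fact
  note S = R.regular_right_module
  interpret S: right_module R "regular_right_module R" by (rule S)
  note Q = R.quotient_by_right_ideal[OF I]
  let ?Q = "quotient_right_module (regular_right_module R) I"
  have IR: "I \<subseteq> carrier R" "\<zero>\<^bsub>R\<^esub> \<in> I"
    using S.sub_rmoduleD(1,2) I by (auto simp: right_ideal_def)
  have coset: "I +>\<^bsub>R\<^esub> x = I \<longleftrightarrow> x \<in> I" if "x \<in> carrier R" for x
    using Q(5)[OF that R.zero_closed] R.a_coset_add_zero[OF IR(1)] that by (simp add: a_minus_def)
  \<comment> \<open>moves \<open>R / I\<close> into the type quantified over in \<^const>\<open>right_perfect\<close>\<close>
  define \<phi> :: "'a set \<Rightarrow> (nat \<Rightarrow> 'a) set" where "\<phi> A = (\<lambda>a n. a) ` A" for A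
  have "inj (\<lambda>(a :: 'a) (n :: nat). a)" by (auto simp: inj_def dest: fun_cong)
  then have "inj_on \<phi> (carrier ?Q)" by (auto simp: \<phi>_def inj_on_def inj_image_eq_iff)
  then obtain M :: "('a, (nat \<Rightarrow> 'a) set) module" and \<psi> where "mod_iso R ?Q M \<phi> \<psi>"
    using inj_imp_mod_iso[OF Q(1)] by blast
  then have M: "right_module R M" "\<phi> \<in> mod_hom R ?Q M" "\<psi> \<in> mod_hom R M ?Q"
      "\<And>x. x \<in> carrier ?Q \<Longrightarrow> \<psi> (\<phi> x) = x" "\<And>y. y \<in> carrier M \<Longrightarrow> \<phi> (\<psi> y) = y"
    by (auto simp: mod_iso_def)
  \<comment> \<open>The kernel of the epimorphism from R onto the copy M is exactly I.\<close>
  have zero: "\<phi> (I +>\<^bsub>R\<^esub> x) = \<zero>\<^bsub>M\<^esub> \<longleftrightarrow> x \<in> I" if "x \<in> carrier R" for x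
    using coset[OF that] mod_hom_zero[OF Q(1) M(1,2)] mod_hom_zero[OF M(1) Q(1) M(3)]
      M(4)[of "I +>\<^bsub>R\<^esub> x"] Q(3,4) that by (metis imageI)
  have "\<not> projective_cover R P f M" for P :: "('a, (nat \<Rightarrow> 'a) set \<Rightarrow> 'a) module" and f
  proof (rule no_projective_cover[OF M(1) mod_hom_comp[OF Q(2) M(2)]])
    have "carrier M \<subseteq> \<phi> ` carrier ?Q" using M(5) mod_homD(1)[OF M(3)] by (metis imageI subsetI)
    then have "\<phi> ` carrier ?Q = carrier M" using mod_homD(1)[OF M(2)] by auto
    then show "(\<lambda>x. \<phi> (I +>\<^bsub>R\<^esub> x)) ` carrier R = carrier M" using Q(3) by (metis image_image)
    show "\<phi> (I +>\<^bsub>R\<^esub> \<one>\<^bsub>R\<^esub>) \<noteq> \<zero>\<^bsub>M\<^esub>" using zero one by simp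
    show "\<exists>q\<in>carrier R. \<phi> (I +>\<^bsub>R\<^esub> q) = \<zero>\<^bsub>M\<^esub> \<and>
        (\<forall>r\<in>carrier R. e \<otimes>\<^bsub>R\<^esub> ((\<one>\<^bsub>R\<^esub> \<ominus>\<^bsub>R\<^esub> q) \<otimes>\<^bsub>R\<^esub> r) \<noteq> e)"
      if "e \<in> carrier R" "e \<noteq> \<zero>\<^bsub>R\<^esub>" for e
      using q[OF that] zero IR by (meson subsetD)
  qed
  then show ?thesis using M(1) by (auto simp: right_perfect_def)
qed

section \<open>Endomorphism rings\<close>

text \<open>
  A left module is a right module over the opposite ring, which makes the results on linear
  combinations in right modules available for \<open>V\<close>.
\<close>

definition opposite_ring :: "('a, 'x) ring_scheme \<Rightarrow> ('a, 'x) ring_scheme" where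
  "opposite_ring R = R\<lparr>mult := \<lambda>a b. b \<otimes>\<^bsub>R\<^esub> a\<rparr>"

lemma opposite_ring_simps [simp]:
  "carrier (opposite_ring R) = carrier R"
  "zero (opposite_ring R) = zero R"
  "one (opposite_ring R) = one R"
  "add (opposite_ring R) = add R"
  "mult (opposite_ring R) = (\<lambda>a b. b \<otimes>\<^bsub>R\<^esub> a)"
  by (simp_all add: opposite_ring_def)

lemma (in ring) opposite_ring: "ring (opposite_ring R)"
proof (rule ringI)
  show "abelian_group (opposite_ring R)"
  proof (rule abelian_groupI)
    show "\<exists>y\<in>carrier (opposite_ring R). y \<oplus>\<^bsub>opposite_ring R\<^esub> x = \<zero>\<^bsub>opposite_ring R\<^esub>"
      if "x \<in> carrier (opposite_ring R)" for x
      using that by (intro bexI[where x = "\<ominus> x"]) (auto simp: l_neg)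
  qed (auto simp: a_assoc a_comm a_lcomm)
  show "monoid (opposite_ring R)" by (rule monoidI) (auto simp: m_assoc)
qed (auto simp: l_distr r_distr)

lemma (in left_module) opposite_right_module: "right_module (opposite_ring R) M"
  by (intro right_module.intro R.opposite_ring M.abelian_group_axioms right_module_axioms.intro)
    (auto simp: lsmult_add_scalar lsmult_add_vector lsmult_assoc)

text \<open>Refines \<open>lin_comb_unit\<close> by naming the coefficient family, which is needed
  to identify the coordinates of a basis vector.\<close>

lemma lin_comb_delta:
  assumes M: "right_module R M" and g: "g \<in> A \<rightarrow> carrier M" and i: "i \<in> A"
  shows "(\<lambda>j. if j = i then \<one>\<^bsub>R\<^esub> else \<zero>\<^bsub>R\<^esub>) \<in> carrier (free_right_module R A)"
    and "lin_comb R M g (\<lambda>j. if j = i then \<one>\<^bsub>R\<^esub> else \<zero>\<^bsub>R\<^esub>) = g i"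
proof -
  interpret M: right_module R M by fact
  let ?c = "\<lambda>j. if j = i then \<one>\<^bsub>R\<^esub> else \<zero>\<^bsub>R\<^esub>"
  show c: "?c \<in> carrier (free_right_module R A)"
    using i finite_subset[of "{j. ?c j \<noteq> \<zero>\<^bsub>R\<^esub>}" "{i}"]
    by (auto simp: free_right_module_def split: if_splits)
  have "lin_comb R M g ?c = (\<Oplus>\<^bsub>M\<^esub>j\<in>{i}. g j \<triangleleft>\<^bsub>M\<^esub> ?c j)"
    by (rule lin_comb_superset[OF M g c]) (use i in auto)
  then show "lin_comb R M g ?c = g i" using g i by (auto simp: Pi_iff)
qed

lemma mod_hom_injI:
  assumes M: "right_module R M" and N: "right_module R N" and f: "f \<in> mod_hom R M N"
    and ker: "\<And>x. \<lbrakk>x \<in> carrier M; f x = \<zero>\<^bsub>N\<^esub>\<rbrakk> \<Longrightarrow> x = \<zero>\<^bsub>M\<^esub>"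
  shows "inj_on f (carrier M)"
proof (rule inj_onI)
  interpret M: right_module R M by fact
  interpret N: right_module R N by fact
  fix x y assume xy: "x \<in> carrier M" "y \<in> carrier M" "f x = f y"
  have "f (x \<ominus>\<^bsub>M\<^esub> y) = \<zero>\<^bsub>N\<^esub>"
    using xy mod_homD[OF f] mod_hom_uminus[OF M N f] by (simp add: a_minus_def N.M.r_neg)
  then show "x = y" using ker[of "x \<ominus>\<^bsub>M\<^esub> y"] xy M.M.minus_eq_zero_iff[of x y] by simp
qed

section \<open>The ring of endomorphisms, computed pointwise\<close>

lemma endo_ring_simps:
  "r \<in> carrier (endo_ring K V) \<longleftrightarrow> r \<in> mod_hom K V V \<and> r \<in> extensional (carrier V)"
  "mult (endo_ring K V) = (\<lambda>r s. compose (carrier V) s r)"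
  "one (endo_ring K V) = (\<lambda>v\<in>carrier V. v)"
  "zero (endo_ring K V) = (\<lambda>v\<in>carrier V. \<zero>\<^bsub>V\<^esub>)"
  "add (endo_ring K V) = (\<lambda>r s. \<lambda>v\<in>carrier V. r v \<oplus>\<^bsub>V\<^esub> s v)"
  by (auto simp: endo_ring_def)

text \<open>Outside the carrier both maps are \<open>undefined\<close>, so agreement on the carrier
  is equality.\<close>

lemma endo_ring_eqI:
  assumes "r \<in> carrier (endo_ring K V)" "s \<in> carrier (endo_ring K V)"
    and "\<And>v. v \<in> carrier V \<Longrightarrow> r v = s v"
  shows "r = s"
  using assms by (auto simp: endo_ring_simps intro: extensionalityI)

lemma endo_ring_closed:
  "r \<in> carrier (endo_ring K V) \<Longrightarrow> v \<in> carrier V \<Longrightarrow> r v \<in> carrier V"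
  by (auto simp: endo_ring_simps dest: mod_homD(1))

lemma (in left_module) endo_ring: "ring (endo_ring R M)"
proof -
  let ?E = "endo_ring R M"
  note eqI = endo_ring_eqI[where K = R and V = M]
  have lin1: "r x \<in> carrier M" if "r \<in> carrier ?E" "x \<in> carrier M" for r x
    by (rule endo_ring_closed[OF that])
  have lin: "r (x \<oplus>\<^bsub>M\<^esub> y) = r x \<oplus>\<^bsub>M\<^esub> r y"
    if "r \<in> carrier ?E" "x \<in> carrier M" "y \<in> carrier M" for r x y
    using that by (auto simp: endo_ring_simps dest: mod_homD(2))
  have lin_smult: "r (a \<odot>\<^bsub>M\<^esub> x) = a \<odot>\<^bsub>M\<^esub> r x"
    if "r \<in> carrier ?E" "x \<in> carrier M" "a \<in> carrier R" for r x a
    using that by (auto simp: endo_ring_simps dest: mod_homD(3))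
  \<comment> \<open>Common source of all closure properties: a map that is linear on the carrier
    becomes a ring element once restricted to it.\<close>
  have restrict: "(\<lambda>v\<in>carrier M. h v) \<in> carrier ?E"
    if "\<And>x. x \<in> carrier M \<Longrightarrow> h x \<in> carrier M"
      "\<And>x y. \<lbrakk>x \<in> carrier M; y \<in> carrier M\<rbrakk> \<Longrightarrow> h (x \<oplus>\<^bsub>M\<^esub> y) = h x \<oplus>\<^bsub>M\<^esub> h y"
      "\<And>x a. \<lbrakk>x \<in> carrier M; a \<in> carrier R\<rbrakk> \<Longrightarrow> h (a \<odot>\<^bsub>M\<^esub> x) = a \<odot>\<^bsub>M\<^esub> h x" for h
    using that by (auto simp: endo_ring_simps mod_hom_def)
  have smult_zero: "a \<odot>\<^bsub>M\<^esub> \<zero>\<^bsub>M\<^esub> = \<zero>\<^bsub>M\<^esub>" "a \<odot>\<^bsub>M\<^esub> (\<ominus>\<^bsub>M\<^esub> x) = \<ominus>\<^bsub>M\<^esub> (a \<odot>\<^bsub>M\<^esub> x)"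
    if "a \<in> carrier R" "x \<in> carrier M" for a x
  proof -
    show zero: "a \<odot>\<^bsub>M\<^esub> \<zero>\<^bsub>M\<^esub> = \<zero>\<^bsub>M\<^esub>"
      using right_module.rsmult_zero_vector[OF opposite_right_module, of a] that by simp
    have "a \<odot>\<^bsub>M\<^esub> (\<ominus>\<^bsub>M\<^esub> x) \<oplus>\<^bsub>M\<^esub> a \<odot>\<^bsub>M\<^esub> x = \<zero>\<^bsub>M\<^esub>"
      using that zero lsmult_add_vector[of a "\<ominus>\<^bsub>M\<^esub> x" x] by (simp add: M.l_neg)
    then show "a \<odot>\<^bsub>M\<^esub> (\<ominus>\<^bsub>M\<^esub> x) = \<ominus>\<^bsub>M\<^esub> (a \<odot>\<^bsub>M\<^esub> x)"
      using that by (intro M.minus_equality[symmetric]) auto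
  qed
  have add: "r \<oplus>\<^bsub>?E\<^esub> s \<in> carrier ?E" if "r \<in> carrier ?E" "s \<in> carrier ?E" for r s
    unfolding endo_ring_simps(5) using that
    by (intro restrict) (simp_all add: lin lin_smult lin1 M.a_assoc M.a_comm M.a_lcomm lsmult_add_vector)
  have mult: "r \<otimes>\<^bsub>?E\<^esub> s \<in> carrier ?E" if "r \<in> carrier ?E" "s \<in> carrier ?E" for r s
    unfolding endo_ring_simps(2) compose_def using that
    by (intro restrict) (simp_all add: lin lin_smult lin1)
  have zero: "\<zero>\<^bsub>?E\<^esub> \<in> carrier ?E"
    unfolding endo_ring_simps(4) by (intro restrict) (simp_all add: smult_zero)
  have one: "\<one>\<^bsub>?E\<^esub> \<in> carrier ?E"
    unfolding endo_ring_simps(3) by (intro restrict) simp_all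
  have neg: "(\<lambda>v\<in>carrier M. \<ominus>\<^bsub>M\<^esub> r v) \<in> carrier ?E" if "r \<in> carrier ?E" for r
    using that by (intro restrict) (simp_all add: lin lin_smult lin1 M.minus_add smult_zero)
  show ?thesis
  proof (rule ringI)
    show "abelian_group ?E"
    proof (rule abelian_groupI)
      show "r \<oplus>\<^bsub>?E\<^esub> s \<oplus>\<^bsub>?E\<^esub> t = r \<oplus>\<^bsub>?E\<^esub> (s \<oplus>\<^bsub>?E\<^esub> t)"
        if "r \<in> carrier ?E" "s \<in> carrier ?E" "t \<in> carrier ?E" for r s t
        using that by (intro eqI add) (simp_all add: endo_ring_simps(5) lin1 M.a_assoc)
      show "r \<oplus>\<^bsub>?E\<^esub> s = s \<oplus>\<^bsub>?E\<^esub> r" if "r \<in> carrier ?E" "s \<in> carrier ?E" for r s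
        using that by (intro eqI add) (simp_all add: endo_ring_simps(5) lin1 M.a_comm)
      show "\<zero>\<^bsub>?E\<^esub> \<oplus>\<^bsub>?E\<^esub> r = r" if "r \<in> carrier ?E" for r
        using that by (intro eqI add zero) (simp_all add: endo_ring_simps(4,5) lin1)
      show "\<exists>s\<in>carrier ?E. s \<oplus>\<^bsub>?E\<^esub> r = \<zero>\<^bsub>?E\<^esub>" if "r \<in> carrier ?E" for r
        using that
        by (intro bexI[OF _ neg] eqI add zero neg)
          (simp_all add: endo_ring_simps(4,5) lin1 M.l_neg)
    qed (rule add zero; assumption)+
    show "monoid ?E"
    proof (rule monoidI)
      show "r \<otimes>\<^bsub>?E\<^esub> s \<otimes>\<^bsub>?E\<^esub> t = r \<otimes>\<^bsub>?E\<^esub> (s \<otimes>\<^bsub>?E\<^esub> t)"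
        if "r \<in> carrier ?E" "s \<in> carrier ?E" "t \<in> carrier ?E" for r s t
        using that by (intro eqI mult) (simp_all add: endo_ring_simps(2) compose_def lin1)
      show "\<one>\<^bsub>?E\<^esub> \<otimes>\<^bsub>?E\<^esub> r = r" if "r \<in> carrier ?E" for r
        using that
        by (intro eqI mult one) (simp_all add: endo_ring_simps(2,3) compose_def lin1)
      show "r \<otimes>\<^bsub>?E\<^esub> \<one>\<^bsub>?E\<^esub> = r" if "r \<in> carrier ?E" for r
        using that
        by (intro eqI mult one) (simp_all add: endo_ring_simps(2,3) compose_def lin1)
    qed (rule mult one; assumption)+
    \<comment> \<open>Since products apply the left factor first, this distributive law rests on the
      additivity of \<open>t\<close>, whereas the other one holds pointwise by the definition of the
      sum.\<close>
    show "(r \<oplus>\<^bsub>?E\<^esub> s) \<otimes>\<^bsub>?E\<^esub> t = r \<otimes>\<^bsub>?E\<^esub> t \<oplus>\<^bsub>?E\<^esub> s \<otimes>\<^bsub>?E\<^esub> t"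
      if "r \<in> carrier ?E" "s \<in> carrier ?E" "t \<in> carrier ?E" for r s t
      using that
      by (intro eqI mult add) (simp_all add: endo_ring_simps(2,5) compose_def lin lin1)
    show "t \<otimes>\<^bsub>?E\<^esub> (r \<oplus>\<^bsub>?E\<^esub> s) = t \<otimes>\<^bsub>?E\<^esub> r \<oplus>\<^bsub>?E\<^esub> t \<otimes>\<^bsub>?E\<^esub> s"
      if "r \<in> carrier ?E" "s \<in> carrier ?E" "t \<in> carrier ?E" for r s t
      using that
      by (intro eqI mult add) (simp_all add: endo_ring_simps(2,5) compose_def lin1)
  qed
qed

text \<open>Negation in the ring is given abstractly as an inverse, so its values are found by
  evaluating the inverse law at \<open>v\<close>.\<close>

lemma (in left_module) endo_ring_uminus_apply:
  assumes r: "r \<in> carrier (endo_ring R M)" and v: "v \<in> carrier M"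
  shows "(\<ominus>\<^bsub>endo_ring R M\<^esub> r) v = \<ominus>\<^bsub>M\<^esub> r v"
proof -
  interpret E: ring "endo_ring R M" by (rule endo_ring)
  have "(\<ominus>\<^bsub>endo_ring R M\<^esub> r) v \<oplus>\<^bsub>M\<^esub> r v = \<zero>\<^bsub>M\<^esub>"
    using fun_cong[OF E.l_neg[OF r], of v] v by (simp add: endo_ring_simps(4,5))
  then show ?thesis
    using endo_ring_closed[OF r v] endo_ring_closed[OF E.a_inv_closed[OF r] v]
    by (intro M.minus_equality[symmetric])
qed

lemma (in left_module) endo_ring_minus_apply:
  assumes "r \<in> carrier (endo_ring R M)" "s \<in> carrier (endo_ring R M)" "v \<in> carrier M"
  shows "(r \<ominus>\<^bsub>endo_ring R M\<^esub> s) v = r v \<ominus>\<^bsub>M\<^esub> s v"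
  using endo_ring_uminus_apply[of s v] assms by (simp add: a_minus_def endo_ring_simps(5))

text \<open>The sum is formed in the regular module because \<open>lin_comb\<close> with values
  there takes its sums in it.\<close>

lemma (in left_module) endo_ring_finsum_apply:
  assumes "finite S" "h \<in> S \<rightarrow> carrier (endo_ring R M)" and v: "v \<in> carrier M"
  shows "finsum (regular_right_module (endo_ring R M)) h S v = (\<Oplus>\<^bsub>M\<^esub>i\<in>S. h i v)"
  using assms(1,2)
proof (induction S)
  interpret E: right_module "endo_ring R M" "regular_right_module (endo_ring R M)"
    by (rule ring.regular_right_module[OF endo_ring])
  case empty
  then show ?case using v by (simp add: endo_ring_simps)
next
  interpret E: right_module "endo_ring R M" "regular_right_module (endo_ring R M)"
    by (rule ring.regular_right_module[OF endo_ring])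
  case (insert i S)
  then have "(\<lambda>i. h i v) \<in> S \<rightarrow> carrier M" "h i v \<in> carrier M"
    using v by (auto intro: endo_ring_closed)
  then show ?case using insert v by (simp add: endo_ring_simps(5))
qed

section \<open>Modules with a basis\<close>

locale based_module = left_module K V for K :: "('k, 'x) ring_scheme" and V :: "('k, 'v) module" +
  fixes B :: "'v set"
  assumes basis: "is_basis K V B"
begin

abbreviation coords where "coords \<equiv> free_right_module (opposite_ring K) B"

abbreviation comb where "comb \<equiv> lin_comb (opposite_ring K) V"

abbreviation E where "E \<equiv> endo_ring K V"

abbreviation E_mod where "E_mod \<equiv> regular_right_module E"

definition coord :: "'v \<Rightarrow> 'v \<Rightarrow> 'k" where
  "coord = inv_into (carrier coords) (comb (\<lambda>b. b))"

text \<open>Linear extension of a map given on the basis: each basis vector in the expansion of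
  \<open>v\<close> is replaced by its value. The restriction to the carrier makes the result an
  element of \<open>E\<close>.\<close>

definition extend :: "('v \<Rightarrow> 'v) \<Rightarrow> 'v \<Rightarrow> 'v" where
  "extend \<phi> = (\<lambda>v\<in>carrier V. comb \<phi> (coord v))"

lemma opposite: "right_module (opposite_ring K) V"
  by (rule opposite_right_module)

lemma coords: "right_module (opposite_ring K) coords"
  by (rule free_right_module) (rule R.opposite_ring)

lemma basis_closed: "B \<subseteq> carrier V"
  using basis by (simp add: is_basis_def generates_def)

lemma basis_independent:
  assumes "finite A" "A \<subseteq> B" "c \<in> A \<rightarrow> carrier K" "(\<Oplus>\<^bsub>V\<^esub>b\<in>A. c b \<odot>\<^bsub>V\<^esub> b) = \<zero>\<^bsub>V\<^esub>" "b \<in> A"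
  shows "c b = \<zero>\<^bsub>K\<^esub>"
  using assms basis unfolding is_basis_def by blast

lemma comb_hom:
  assumes "\<phi> \<in> B \<rightarrow> carrier V"
  shows "comb \<phi> \<in> mod_hom (opposite_ring K) coords V"
  by (rule lin_comb_hom[OF opposite assms])

lemma id_hom: "comb (\<lambda>b. b) \<in> mod_hom (opposite_ring K) coords V"
  using basis_closed by (intro comb_hom) auto

lemma comb_surj: "comb (\<lambda>b. b) ` carrier coords = carrier V"
proof (rule lin_comb_generates[OF opposite])
  show "generates (opposite_ring K) V B"
    using basis by (simp add: is_basis_def generates_def submodule_def submodule_axioms_def)
qed

text \<open>Independence is applied to the support of \<open>c\<close>: all coefficients there
  vanish, so the support is empty.\<close>

lemma comb_inj: "inj_on (comb (\<lambda>b. b)) (carrier coords)"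
proof (rule mod_hom_injI[OF coords opposite id_hom])
  fix c assume c: "c \<in> carrier coords" and zero: "comb (\<lambda>b. b) c = \<zero>\<^bsub>V\<^esub>"
  let ?A = "{i. c i \<noteq> \<zero>\<^bsub>K\<^esub>}"
  have "c b = \<zero>\<^bsub>K\<^esub>" if "b \<in> ?A" for b
    by (rule basis_independent[of ?A c])
      (use c zero that in \<open>auto simp: free_right_module_def lin_comb_def\<close>)
  then show "c = \<zero>\<^bsub>coords\<^esub>" by (auto simp: free_right_module_def)
qed

lemma coord_hom: "coord \<in> mod_hom (opposite_ring K) V coords"
  unfolding coord_def by (rule mod_hom_inv_into[OF coords id_hom comb_inj comb_surj])

lemma coord_comb: "c \<in> carrier coords \<Longrightarrow> coord (comb (\<lambda>b. b) c) = c"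
  unfolding coord_def by (rule inv_into_f_f[OF comb_inj])

lemma comb_coord: "v \<in> carrier V \<Longrightarrow> comb (\<lambda>b. b) (coord v) = v"
  unfolding coord_def using f_inv_into_f[of v "comb (\<lambda>b. b)" "carrier coords"]
  by (simp only: comb_surj)

lemma coord_closed: "v \<in> carrier V \<Longrightarrow> coord v \<in> carrier coords"
  by (rule mod_homD(1)[OF coord_hom])

lemma extend_closed:
  assumes "\<phi> \<in> B \<rightarrow> carrier V" shows "extend \<phi> \<in> carrier E"
  using mod_hom_comp[OF coord_hom comb_hom[OF assms]]
  by (auto simp: endo_ring_simps extend_def mod_hom_def)

lemma extend_basis:
  assumes \<phi>: "\<phi> \<in> B \<rightarrow> carrier V" and b: "b \<in> B"
  shows "extend \<phi> b = \<phi> b"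
proof -
  have id: "(\<lambda>b. b) \<in> B \<rightarrow> carrier V" using basis_closed by auto
  note d = lin_comb_delta[OF opposite id b] lin_comb_delta(2)[OF opposite \<phi> b]
  then show ?thesis using coord_comb[OF d(1)] b basis_closed by (auto simp: extend_def)
qed

text \<open>Apply \<open>r\<close> to the expansion of \<open>v\<close>. Of the ring,
  \<open>mod_hom\<close> only reads the carrier, so linearity over K and over its opposite ring is
  the same.\<close>

lemma endo_comb:
  assumes r: "r \<in> carrier E" and v: "v \<in> carrier V"
  shows "r v = comb r (coord v)"
proof -
  have "r \<in> mod_hom (opposite_ring K) V V" using r by (simp add: endo_ring_simps mod_hom_def)
  from mod_hom_lin_comb[OF opposite opposite this _ coord_closed[OF v], of "\<lambda>b. b"]
  show ?thesis using basis_closed comb_coord[OF v] by auto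
qed

text \<open>Agreement is demanded only where the coefficient is nonzero. This allows comparing the
  identity with a map that fixes just the basis vectors occurring in a given vector.\<close>

lemma comb_cong:
  assumes "c \<in> carrier coords" "\<phi> \<in> B \<rightarrow> carrier V" "\<And>b. c b \<noteq> \<zero>\<^bsub>K\<^esub> \<Longrightarrow> \<phi> b = \<psi> b"
  shows "comb \<phi> c = comb \<psi> c"
  unfolding lin_comb_def
proof (rule M.finsum_cong'[OF refl])
  have c: "c b \<in> carrier K" "c b \<noteq> \<zero>\<^bsub>K\<^esub> \<Longrightarrow> b \<in> B" for b
    using assms(1) by (auto simp: free_right_module_def)
  show "(\<lambda>b. \<psi> b \<triangleleft>\<^bsub>V\<^esub> c b) \<in> {b. c b \<noteq> \<zero>\<^bsub>opposite_ring K\<^esub>} \<rightarrow> carrier V"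
    using c assms(2) by (auto simp: Pi_iff assms(3)[symmetric])
qed (simp add: assms(3))

lemma endo_eq_on_basis:
  assumes r: "r \<in> carrier E" and s: "s \<in> carrier E" and eq: "\<And>b. b \<in> B \<Longrightarrow> r b = s b"
  shows "r = s"
proof (rule endo_ring_eqI[OF r s])
  fix v assume v: "v \<in> carrier V"
  have "comb r (coord v) = comb s (coord v)"
  proof (rule comb_cong[OF coord_closed[OF v]])
    show "r \<in> B \<rightarrow> carrier V" using endo_ring_closed[OF r] basis_closed by auto
    show "r b = s b" if "coord v b \<noteq> \<zero>\<^bsub>K\<^esub>" for b
      using that coord_closed[OF v] eq by (auto simp: free_right_module_def)
  qed
  then show "r v = s v" using endo_comb[OF r v] endo_comb[OF s v] by simp
qed

section \<open>Free modules inside the endomorphism ring\<close>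

lemma E_ring: "ring E" by (rule endo_ring)

text \<open>An injection of \<open>B \<times> X\<close> into B marks disjoint blocks of the basis,
  one copy of B for each \<open>y\<close> in X. The generator at \<open>y\<close> goes to the
  endomorphism that reads off block \<open>y\<close>, so every coefficient can be recovered from the
  values on its block.\<close>

lemma free_module_embeds:
  assumes inf: "infinite B" and X: "|X| \<le>o |B|"
  shows "\<exists>j \<in> mod_hom E (free_right_module E X) E_mod. inj_on j (carrier (free_right_module E X))"
proof -
  interpret E: ring E by (rule E_ring)
  have S: "right_module E E_mod" by (rule E.regular_right_module)
  let ?F = "free_right_module E X"
  have F: "right_module E ?F" by (rule free_right_module) (rule E_ring)
  have "|B \<times> X| \<le>o |B|"
    by (rule card_of_Times_ordLeq_infinite_Field)
      (use inf X in \<open>auto simp: Field_card_of card_of_card_order_on card_of_mono1\<close>)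
  then obtain pr where pr: "inj_on pr (B \<times> X)" "pr ` (B \<times> X) \<subseteq> B"
    by (auto simp: card_of_ordLeq[symmetric])
  \<comment> \<open>\<open>g y\<close> sends \<open>pr (b, y)\<close> to \<open>b\<close> and the rest of the basis to \<open>0\<close>, so a combination of
    the \<open>g y\<close> with coefficients \<open>c y\<close> (applied after \<open>g y\<close>) takes \<open>pr (b, y)\<close> to \<open>c y b\<close>.\<close>
  define g where "g y = extend (\<lambda>b'. if \<exists>b\<in>B. b' = pr (b, y)
    then THE b. b \<in> B \<and> b' = pr (b, y) else \<zero>\<^bsub>V\<^esub>)" for y
  have BV: "b \<in> carrier V" if "b \<in> B" for b using that basis_closed by auto
  have pr_the: "(THE b'. b' \<in> B \<and> pr (b, y) = pr (b', y)) = b" if "b \<in> B" "y \<in> X" for b y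
    using that inj_onD[OF pr(1), of "(b, y)"] by (intro the_equality) auto
  have sel: "(\<lambda>b'. if \<exists>b\<in>B. b' = pr (b, y)
      then THE b. b \<in> B \<and> b' = pr (b, y) else \<zero>\<^bsub>V\<^esub>) \<in> B \<rightarrow> carrier V" if "y \<in> X" for y
    using pr_the[OF _ that] BV by auto
  have g: "g \<in> X \<rightarrow> carrier E" using extend_closed[OF sel] by (auto simp: g_def)
  have g_pr: "g y (pr (b, z)) = (if y = z then b else \<zero>\<^bsub>V\<^esub>)"
    if "b \<in> B" "y \<in> X" "z \<in> X" for b y z
  proof -
    have "pr (b, z) \<in> B" using that pr(2) by blast
    moreover have "(\<exists>b'\<in>B. pr (b, z) = pr (b', y)) \<longleftrightarrow> y = z"
      using that inj_onD[OF pr(1), of "(b, z)"] by auto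
    ultimately show ?thesis
      using pr_the[OF that(1,2)] extend_basis[OF sel[OF that(2)]] by (auto simp: g_def)
  qed
  let ?j = "lin_comb E E_mod g"
  have g': "g \<in> X \<rightarrow> carrier E_mod" using g by simp
  have zero_apply: "r \<zero>\<^bsub>V\<^esub> = \<zero>\<^bsub>V\<^esub>" if "r \<in> carrier E" for r
    using that mod_hom_zero[OF opposite opposite, of r] by (simp add: endo_ring_simps mod_hom_def)
  have j_pr: "?j c (pr (b, y)) = c y b" if c: "c \<in> carrier ?F" and b: "b \<in> B" and y: "y \<in> X" for c b y
  proof -
    \<comment> \<open>Inserting \<open>y\<close> keeps its term in the sum even when
      \<open>c y\<close> is zero, which avoids a case distinction.\<close>
    let ?S = "insert y {i. c i \<noteq> \<zero>\<^bsub>E\<^esub>}"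
    have cS: "finite ?S" "?S \<subseteq> X" "\<And>i. c i \<in> carrier E"
      using c y by (auto simp: free_right_module_def)
    have pb: "pr (b, y) \<in> carrier V" using b y pr(2) basis_closed by blast
    have bV: "b \<in> carrier V" using b basis_closed by blast
    have "?j c = finsum E_mod (\<lambda>i. g i \<otimes>\<^bsub>E\<^esub> c i) ?S"
      using lin_comb_superset[OF S g' c cS(1) _ cS(2)] by auto
    then have "?j c (pr (b, y)) = (\<Oplus>\<^bsub>V\<^esub>i\<in>?S. (g i \<otimes>\<^bsub>E\<^esub> c i) (pr (b, y)))"
      using endo_ring_finsum_apply[OF cS(1) _ pb, of "\<lambda>i. g i \<otimes>\<^bsub>E\<^esub> c i"] g cS
      by (simp add: Pi_iff subset_iff)
    also have "\<dots> = (\<Oplus>\<^bsub>V\<^esub>i\<in>?S. if y = i then c i b else \<zero>\<^bsub>V\<^esub>)"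
    proof (rule M.finsum_cong'[OF refl])
      show "(\<lambda>i. if y = i then c i b else \<zero>\<^bsub>V\<^esub>) \<in> ?S \<rightarrow> carrier V"
        using endo_ring_closed[OF cS(3) bV] by auto
      fix i assume "i \<in> ?S"
      then show "(g i \<otimes>\<^bsub>E\<^esub> c i) (pr (b, y)) = (if y = i then c i b else \<zero>\<^bsub>V\<^esub>)"
        using g_pr[OF b _ y, of i] cS(2) pb zero_apply[OF cS(3)]
        by (auto simp: endo_ring_simps(2) compose_def)
    qed
    also have "\<dots> = c y b"
      using endo_ring_closed[OF cS(3) bV] cS(1) by (intro M.finsum_singleton) auto
    finally show ?thesis .
  qed
  have j: "?j \<in> mod_hom E ?F E_mod" by (rule lin_comb_hom[OF S g'])
  moreover have "inj_on ?j (carrier ?F)"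
  proof (rule inj_onI)
    fix c d assume c: "c \<in> carrier ?F" and d: "d \<in> carrier ?F" and eq: "?j c = ?j d"
    have "c y = d y" for y
    proof (cases "y \<in> X")
      case True
      show ?thesis
        using c d j_pr[OF c _ True] j_pr[OF d _ True] eq
        by (intro endo_eq_on_basis) (auto simp: free_right_module_def)
    next
      case False
      then have "c y = \<zero>\<^bsub>E\<^esub>" "d y = \<zero>\<^bsub>E\<^esub>"
        using c d unfolding free_right_module_def by auto
      then show ?thesis by simp
    qed
    then show "c = d" by blast
  qed
  ultimately show ?thesis by blast
qed

lemma R_projective_iff_projective:
  fixes M :: "('v \<Rightarrow> 'v, 'm) module"
  assumes inf: "infinite B" and gen: "generated_by_at_most E M |B|"
  shows "R_projective E M \<longleftrightarrow> projective E M"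
proof
  assume M: "R_projective E M"
  obtain X where X: "generates E M X" "|X| \<le>o |B|"
    using gen by (auto simp: generated_by_at_most_def)
  show "projective E M"
    using free_module_embeds[OF inf X(2)] R_projective_imp_projective[OF M X(1)] by blast
qed (rule projective_imp_R_projective)

section \<open>Failure of right perfectness\<close>

lemma not_right_perfect:
  assumes inf: "infinite B" and K: "\<one>\<^bsub>K\<^esub> \<noteq> \<zero>\<^bsub>K\<^esub>"
  shows "\<not> right_perfect E"
proof -
  interpret E: ring E by (rule E_ring)
  interpret S: right_module E E_mod by (rule E.regular_right_module)
  define I where "I = {q \<in> carrier E. finite {b \<in> B. q b \<noteq> \<zero>\<^bsub>V\<^esub>}}"
  have BV: "b \<in> carrier V" if "b \<in> B" for b using that basis_closed by auto
  have zero_apply: "r \<zero>\<^bsub>V\<^esub> = \<zero>\<^bsub>V\<^esub>" if "r \<in> carrier E" for r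
    using that mod_hom_zero[OF opposite opposite, of r] by (simp add: endo_ring_simps mod_hom_def)
  have fin: "q \<in> I"
    if "q \<in> carrier E" "finite A" "\<And>b. b \<in> B \<Longrightarrow> b \<notin> A \<Longrightarrow> q b = \<zero>\<^bsub>V\<^esub>" for q A
    using that finite_subset[of "{b \<in> B. q b \<noteq> \<zero>\<^bsub>V\<^esub>}" A] by (auto simp: I_def)
  show ?thesis
  proof (rule not_right_perfectI[OF E_ring])
    show "right_ideal I E" unfolding right_ideal_def
    proof (rule S.sub_rmoduleI)
      show "I \<subseteq> carrier E_mod" by (auto simp: I_def)
      show "\<zero>\<^bsub>E_mod\<^esub> \<in> I"
        using BV E.zero_closed by (intro fin[of _ "{}"]) (auto simp: endo_ring_simps(4))
      show "\<ominus>\<^bsub>E_mod\<^esub> q \<in> I" if "q \<in> I" for q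
      proof -
        have "\<ominus>\<^bsub>E_mod\<^esub> q = \<ominus>\<^bsub>E\<^esub> q" by (simp add: a_inv_def m_inv_def)
        moreover have "\<ominus>\<^bsub>E\<^esub> q \<in> I"
          using that BV E.a_inv_closed[of q] endo_ring_uminus_apply
          by (intro fin[of _ "{b \<in> B. q b \<noteq> \<zero>\<^bsub>V\<^esub>}"]) (auto simp: I_def)
        ultimately show ?thesis by simp
      qed
      show "q \<oplus>\<^bsub>E_mod\<^esub> r \<in> I" if "q \<in> I" "r \<in> I" for q r
        using that BV E.a_closed[of q r]
        by (intro fin[of _ "{b \<in> B. q b \<noteq> \<zero>\<^bsub>V\<^esub>} \<union> {b \<in> B. r b \<noteq> \<zero>\<^bsub>V\<^esub>}"])
          (auto simp: I_def endo_ring_simps(5))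
      \<comment> \<open>The right action multiplies to \<open>q \<otimes> a\<close>, which applies
        \<open>q\<close> first. Basis vectors killed by \<open>q\<close> stay killed, so the
        finiteness condition defines a right ideal.\<close>
      show "a \<odot>\<^bsub>E_mod\<^esub> q \<in> I" if "a \<in> carrier E" "q \<in> I" for a q
        using that BV E.m_closed[of q a]
        by (intro fin[of _ "{b \<in> B. q b \<noteq> \<zero>\<^bsub>V\<^esub>}"])
          (auto simp: I_def endo_ring_simps(2) compose_def zero_apply)
    qed
    \<comment> \<open>A zero basis vector would give a vanishing combination with coefficient 1.
      Hence the identity is nonzero on all of the infinite set B and lies outside I.\<close>
    have "b \<noteq> \<zero>\<^bsub>V\<^esub>" if b: "b \<in> B" for b
    proof
      assume "b = \<zero>\<^bsub>V\<^esub>"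
      then have "\<one>\<^bsub>K\<^esub> = \<zero>\<^bsub>K\<^esub>"
        using b by (intro basis_independent[of "{b}" "\<lambda>_. \<one>\<^bsub>K\<^esub>" b]) auto
      then show False using K by simp
    qed
    then have "{b \<in> B. \<one>\<^bsub>E\<^esub> b \<noteq> \<zero>\<^bsub>V\<^esub>} = B" using BV by (auto simp: endo_ring_simps(3))
    then show "\<one>\<^bsub>E\<^esub> \<notin> I" using inf by (simp add: I_def)
    show "\<exists>q\<in>I. \<forall>r\<in>carrier E. e \<otimes>\<^bsub>E\<^esub> ((\<one>\<^bsub>E\<^esub> \<ominus>\<^bsub>E\<^esub> q) \<otimes>\<^bsub>E\<^esub> r) \<noteq> e"
      if e: "e \<in> carrier E" and ne: "e \<noteq> \<zero>\<^bsub>E\<^esub>" for e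
    proof -
      obtain u where u: "u \<in> carrier V" "e u \<noteq> \<zero>\<^bsub>V\<^esub>"
        using ne endo_ring_eqI[OF e E.zero_closed] by (auto simp: endo_ring_simps(4))
      define v where "v = e u"
      have v: "v \<in> carrier V" using endo_ring_closed[OF e u(1)] by (simp add: v_def)
      \<comment> \<open>The finitely many basis vectors occurring in \<open>v\<close>. The
        projection \<open>q\<close> onto their span belongs to I and fixes \<open>v\<close>.\<close>
      let ?A = "{b. coord v b \<noteq> \<zero>\<^bsub>K\<^esub>}"
      have A: "finite ?A" using coord_closed[OF v] by (auto simp: free_right_module_def)
      let ?\<phi> = "\<lambda>b. if b \<in> ?A then b else \<zero>\<^bsub>V\<^esub>"
      have \<phi>: "?\<phi> \<in> B \<rightarrow> carrier V" using BV by auto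
      define q where "q = extend ?\<phi>"
      have q: "q \<in> carrier E" unfolding q_def by (rule extend_closed[OF \<phi>])
      have "q \<in> I" using extend_basis[OF \<phi>] by (intro fin[OF q A]) (simp add: q_def)
      have "q v = comb ?\<phi> (coord v)" using v by (simp add: q_def extend_def)
      also have "\<dots> = v"
        using comb_cong[OF coord_closed[OF v] \<phi>, of "\<lambda>b. b"] comb_coord[OF v] by simp
      finally have "(\<one>\<^bsub>E\<^esub> \<ominus>\<^bsub>E\<^esub> q) v = \<zero>\<^bsub>V\<^esub>"
        using endo_ring_minus_apply[OF E.one_closed q v] v
        by (simp add: endo_ring_simps(3) a_minus_def M.r_neg)
      \<comment> \<open>Reading the product from left to right, \<open>u\<close> goes to
        \<open>v\<close>, then \<open>1 - q\<close> sends \<open>v\<close> to zero, and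
        \<open>r\<close> preserves zero. But \<open>e u\<close> is nonzero.\<close>
      then have "(e \<otimes>\<^bsub>E\<^esub> ((\<one>\<^bsub>E\<^esub> \<ominus>\<^bsub>E\<^esub> q) \<otimes>\<^bsub>E\<^esub> r)) u = \<zero>\<^bsub>V\<^esub>" if "r \<in> carrier E" for r
        using u(1) v zero_apply[OF that] by (simp add: endo_ring_simps(2) compose_def v_def[symmetric])
      then show ?thesis using u(2) \<open>q \<in> I\<close> by metis
    qed
  qed
qed

end

section \<open>A vector space of given dimension over the field with two elements\<close>

lemma free_right_module_zero: "zero (free_right_module R A) = (\<lambda>i. \<zero>\<^bsub>R\<^esub>)"
  and free_right_module_add: "add (free_right_module R A) = (\<lambda>c d i. c i \<oplus>\<^bsub>R\<^esub> d i)"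
  by (simp_all add: free_right_module_def)

lemma (in ring) free_right_module_finsum_apply:
  assumes "finite S" "h \<in> S \<rightarrow> carrier (free_right_module R A)"
  shows "finsum (free_right_module R A) h S i = (\<Oplus>s\<in>S. h s i)"
  using assms
proof (induction S)
  interpret F: right_module R "free_right_module R A" by (rule free_right_module[OF ring_axioms])
  case empty
  then show ?case by (simp add: free_right_module_zero)
next
  interpret F: right_module R "free_right_module R A" by (rule free_right_module[OF ring_axioms])
  case (insert s S)
  then have "(\<lambda>s. h s i) \<in> S \<rightarrow> carrier R" "h s i \<in> carrier R"
    by (auto simp: free_right_module_def)
  moreover have "finsum (free_right_module R A) h (insert s S) i
      = h s i \<oplus> finsum (free_right_module R A) h S i"
    using insert by (simp add: Pi_iff free_right_module_add)
  ultimately show ?case using insert by (simp add: Pi_iff)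
qed

text \<open>Addition is exclusive or. Taking \<open>bool\<close> as the field makes the vector space
  live on functions from the type of \<kappa> to \<open>bool\<close>, as the existence claim
  requires.\<close>

definition F2 :: "bool ring" where
  "F2 = \<lparr>carrier = UNIV, mult = (\<and>), one = True, zero = False, add = (\<noteq>)\<rparr>"

lemma F2_simps [simp]:
  "carrier F2 = UNIV" "mult F2 = (\<and>)" "one F2 = True" "zero F2 = False" "add F2 = (\<noteq>)"
  by (simp_all add: F2_def)

lemma skew_field_F2: "skew_field F2"
proof -
  have "ring F2"
    by (intro ringI abelian_groupI monoidI) auto
  then show ?thesis
    by (auto simp: skew_field_def skew_field_axioms_def Units_def)
qed

text \<open>Conjunction is commutative, so the right module is also a left module under the same
  record.\<close>

lemma left_module_F2: "left_module F2 (free_right_module F2 A)"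
proof -
  have ring: "ring F2" using skew_field_F2 by (simp add: skew_field_def)
  interpret right_module F2 "free_right_module F2 A" by (rule free_right_module[OF ring])
  show ?thesis
    by (intro left_module.intro ring M.abelian_group_axioms left_module_axioms.intro rsmult_closed)
      (auto simp: free_right_module_def)
qed

text \<open>Vectors are indicator functions of finite subsets of A, and the basis consists of the
  indicators of singletons. They generate by induction on the support, splitting off one point at a
  time.\<close>

lemma is_basis_F2: "is_basis F2 (free_right_module F2 A) ((\<lambda>i j. j = i) ` A)"
proof -
  let ?V = "free_right_module F2 A" and ?\<delta> = "\<lambda>i j. j = i"
  have ring: "ring F2" using skew_field_F2 by (simp add: skew_field_def)
  interpret right_module F2 ?V by (rule free_right_module[OF ring])
  have V: "v \<in> carrier ?V \<longleftrightarrow> finite {i. v i} \<and> {i. v i} \<subseteq> A" for v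
    by (simp add: free_right_module_def)
  have \<delta>: "?\<delta> i \<in> carrier ?V" if "i \<in> A" for i using that by (simp add: V)
  have gen: "v \<in> N" if N: "submodule N F2 ?V" "?\<delta> ` A \<subseteq> N" and v: "finite S" "{i. v i} = S" "S \<subseteq> A"
    for N S v
    using v
  proof (induction S arbitrary: v)
    case empty
    then have "v = \<zero>\<^bsub>?V\<^esub>" by (auto simp: free_right_module_zero)
    then show ?case using sub_rmoduleD(2)[OF N(1)] by simp
  next
    case (insert s S)
    let ?w = "v(s := False)"
    have "{i. ?w i} = S" using insert.hyps insert.prems by auto
    then have "?w \<in> N" using insert by simp
    moreover have "?\<delta> s \<in> N" using insert.prems N(2) by blast
    ultimately have "?\<delta> s \<oplus>\<^bsub>?V\<^esub> ?w \<in> N" using sub_rmoduleD(4)[OF N(1)] by blast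
    moreover have "?\<delta> s \<oplus>\<^bsub>?V\<^esub> ?w = v"
      using insert.prems by (auto simp: free_right_module_add fun_eq_iff)
    ultimately show ?case by simp
  qed
  have indep: "\<not> c b" if "finite T" "T \<subseteq> ?\<delta> ` A" "(\<Oplus>\<^bsub>?V\<^esub>b\<in>T. c b \<odot>\<^bsub>?V\<^esub> b) = \<zero>\<^bsub>?V\<^esub>" "b \<in> T" for T c b
  proof -
    from that(2,4) obtain i where i: "i \<in> A" "b = ?\<delta> i" by auto
    have T: "b' \<in> carrier ?V" "b' i \<longleftrightarrow> b = b'" if b': "b' \<in> T" for b'
    proof -
      obtain k where k: "k \<in> A" "b' = ?\<delta> k" using b' \<open>T \<subseteq> ?\<delta> ` A\<close> by auto
      then show "b' \<in> carrier ?V" using \<delta> by simp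
      show "b' i \<longleftrightarrow> b = b'" by (auto simp: k(2) i(2) dest: fun_cong[of _ _ i])
    qed
    \<comment> \<open>At coordinate \<open>i\<close> only the basis vector \<open>b\<close> is
      nonzero, so evaluating the relation there isolates the coefficient \<open>c b\<close>.\<close>
    have "(\<Oplus>\<^bsub>F2\<^esub>b'\<in>T. if b = b' then c b' else \<zero>\<^bsub>F2\<^esub>) = (\<Oplus>\<^bsub>F2\<^esub>b'\<in>T. (c b' \<odot>\<^bsub>?V\<^esub> b') i)"
      using T by (intro R.finsum_cong') (auto simp: free_right_module_def)
    also have "\<dots> = (\<Oplus>\<^bsub>?V\<^esub>b\<in>T. c b \<odot>\<^bsub>?V\<^esub> b) i"
      using that(1) T(1) by (intro R.free_right_module_finsum_apply[symmetric]) auto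
    also have "\<dots> = False" using that(3) by (simp add: free_right_module_zero)
    finally show ?thesis
      using R.finsum_singleton[OF that(4,1), of c] by simp
  qed
  show ?thesis
    unfolding is_basis_def generates_def
  proof (intro conjI allI impI ballI)
    show "?\<delta> ` A \<subseteq> carrier ?V" using \<delta> by blast
    fix N assume "submodule N F2 ?V \<and> ?\<delta> ` A \<subseteq> N"
    then show "N = carrier ?V"
      using gen[of N] sub_rmoduleD(1)[of N] by (auto simp: V)
  qed (use indep in auto)
qed

section \<open>The results for a vector space of dimension \<kappa>\<close>

lemma endo_ring_properties:
  fixes \<kappa> :: "'c rel" and M :: "('v \<Rightarrow> 'v, 'm) module"
  assumes \<kappa>: "Cinfinite \<kappa>" and K: "skew_field K" and V: "left_module K V" "has_dimension K V \<kappa>"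
  shows "ring (endo_ring K V)" "\<not> right_perfect (endo_ring K V)"
    "generated_by_at_most (endo_ring K V) M \<kappa> \<Longrightarrow>
      projective (endo_ring K V) M \<longleftrightarrow> R_projective (endo_ring K V) M"
proof -
  obtain B where B: "is_basis K V B" "|B| =o \<kappa>" using V(2) by (auto simp: has_dimension_def)
  interpret based_module K V B
    using V(1) B(1) by (simp add: based_module_def based_module_axioms_def)
  have inf: "infinite B"
    using \<kappa> B(2) by (metis Cinfinite_cong Field_card_of cinfinite_def ordIso_symmetric)
  show "ring (endo_ring K V)" by (rule E_ring)
  show "\<not> right_perfect (endo_ring K V)"
    using not_right_perfect[OF inf] K by (simp add: skew_field_def skew_field_axioms_def)
  assume "generated_by_at_most (endo_ring K V) M \<kappa>"
  then have "generated_by_at_most (endo_ring K V) M |B|"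
    using B(2) by (meson generated_by_at_most_def ordIso_symmetric ordLeq_ordIso_trans)
  then show "projective (endo_ring K V) M \<longleftrightarrow> R_projective (endo_ring K V) M"
    using R_projective_iff_projective[OF inf] by blast
qed

text \<open>In the existence claim the modules have sets of functions from the type of \<kappa> to
  the ring as elements; by \<open>generated_universe\<close> the equivalence then holds for modules
  over any element type. The witness is the case of the two-element field and the space of finitely
  supported functions on \<open>Field \<kappa>\<close>.\<close>

theorem mainTheorem3:
  fixes \<kappa> :: "'c rel"
  assumes "Cinfinite \<kappa>"
  shows "(\<exists>R :: (('c \<Rightarrow> bool) \<Rightarrow> ('c \<Rightarrow> bool)) ring.
            ring R \<and> \<not> right_perfect R \<and>
            (\<forall>M :: (('c \<Rightarrow> bool) \<Rightarrow> ('c \<Rightarrow> bool), ('c \<Rightarrow> ('c \<Rightarrow> bool) \<Rightarrow> ('c \<Rightarrow> bool)) set) module.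
               right_module R M \<and> generated_by_at_most R M \<kappa> \<longrightarrow>
               (projective R M \<longleftrightarrow> R_projective R M))) \<and>
         (\<forall>(K :: 'k ring) (V :: ('k, 'v) module).
            skew_field K \<and> left_module K V \<and> has_dimension K V \<kappa> \<longrightarrow>
            ring (endo_ring K V) \<and> \<not> right_perfect (endo_ring K V) \<and>
            (\<forall>M :: ('v \<Rightarrow> 'v, 'm) module.
               right_module (endo_ring K V) M \<and> generated_by_at_most (endo_ring K V) M \<kappa> \<longrightarrow>
               (projective (endo_ring K V) M \<longleftrightarrow> R_projective (endo_ring K V) M)))"
proof (intro conjI exI[where x = "endo_ring F2 (free_right_module F2 (Field \<kappa>))"] allI impI)
  let ?V = "free_right_module F2 (Field \<kappa>)"
  have "inj_on (\<lambda>i j. j = i) (Field \<kappa>)" by (rule inj_onI) (metis (full_types))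
  then have "|(\<lambda>i j. j = i) ` Field \<kappa>| =o |Field \<kappa>|"
    by (meson card_of_ordIsoI inj_on_imp_bij_betw ordIso_symmetric)
  also have "|Field \<kappa>| =o \<kappa>" using assms by (simp add: card_of_Field_ordIso)
  finally have "has_dimension F2 ?V \<kappa>" using is_basis_F2 by (auto simp: has_dimension_def)
  note * = endo_ring_properties[OF assms skew_field_F2 left_module_F2 this]
  show "ring (endo_ring F2 ?V)" by (rule *(1))
  show "\<not> right_perfect (endo_ring F2 ?V)" by (rule *(2))
  show "projective (endo_ring F2 ?V) M \<longleftrightarrow> R_projective (endo_ring F2 ?V) M"
    if "right_module (endo_ring F2 ?V) M \<and> generated_by_at_most (endo_ring F2 ?V) M \<kappa>"
    for M :: "(('c \<Rightarrow> bool) \<Rightarrow> ('c \<Rightarrow> bool), ('c \<Rightarrow> ('c \<Rightarrow> bool) \<Rightarrow> ('c \<Rightarrow> bool)) set) module"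
    using that *(3) by blast
qed (use endo_ring_properties[OF assms] in blast)+

end
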